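(* For every integer $n\ge 2$, the generalized $3$-connectivity of the $n$-dimensional burnt pancake graph satisfies $\kappa_3(BP_n)=n-1$.
   Context: Let $[n]=\{1,\dots,n\}$ and write $\bar i=-i$; let $[[n]]=[n]\cup\{\bar i: i\in[n]\}$. A signed permutation of $[n]$ is a sequence $x=x_1x_2\cdots x_n$ of elements of $[[n]]$ such that $|x_1||x_2|\cdots|x_n|$ is a permutation of $[n]$. For $1\le i\le n$, the $i$th signed prefix reversal of $x$ is $x^i=\bar x_i\bar x_{i-1}\cdots\bar x_1x_{i+1}\cdots x_n$. The $n$-dimensional burnt pancake graph $BP_n$ ($n\ge2$) has as vertices all signed permutations of $[n]$, with $x$ and $y$ adjacent iff $y=x^i$ for some $1\le i\le n$. For a graph $G$ and $S\subseteq V(G)$, an $S$-tree is a tree $T$ in $G$ with $S\subseteq V(T)$; $S$-trees $T_1,\dots,T_r$ are internally edge disjoint if $V(T_i)\cap V(T_j)=S$ and $E(T_i)\cap E(T_j)=\emptyset$ for all $i\ne j$. $\kappa_G(S)$ is the maximum number of internally edge disjoint $S$-trees in $G$, and for $2\le k\le|V(G)|$ the generalized $k$-connectivity is $\kappa_k(G)=\min\{\kappa_G(S): S\subseteq V(G),\ |S|=k\}$. *)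

theory Defs
  imports
    "Graph_Theory.Graph_Theory"
    "HOL-Combinatorics.Multiset_Permutations"
begin

section \<open>Burnt pancake graphs\<close>

text \<open>
  The barred symbol of \<open>i\<close> is the integer \<open>- i\<close>.  The entries of a signed permutation
  automatically lie in \<open>{1..n} \<union> {-n..-1}\<close>, because their absolute values lie in \<open>{1..n}\<close>.
\<close>

definition signed_permutations :: "nat \<Rightarrow> int list set" where
  "signed_permutations n = {x. map abs x \<in> permutations_of_set {1..int n}}"

definition signed_prefix_reversal :: "nat \<Rightarrow> int list \<Rightarrow> int list" where
  "signed_prefix_reversal i x = map uminus (rev (take i x)) @ drop i x"

text \<open>Undirected simple graphs are represented as symmetric loop-free digraphs.\<close>

definition burnt_pancake :: "nat \<Rightarrow> int list pair_pre_digraph" where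
  "burnt_pancake n =
    \<lparr> pverts = signed_permutations n,
      parcs = {(x, y). x \<in> signed_permutations n \<and> y \<in> signed_permutations n \<and>
                       (\<exists>i\<in>{1..n}. y = signed_prefix_reversal i x)} \<rparr>"

section \<open>Generalized connectivity\<close>

text \<open>
  The constant \<^const>\<open>tree\<close> is not the notion of an undirected tree: in a symmetric digraph every
  edge gives a closed directed walk of length 2, which counts as a cycle there (and for oriented
  digraphs only directed cycles are excluded).  In a symmetric loop-free digraph without parallel
  arcs, the cycles of the undirected graph are exactly the directed cycles of length at least 3.
\<close>

definition undirected_tree :: "'a pair_pre_digraph \<Rightarrow> bool" where
  "undirected_tree T \<longleftrightarrow>
     pair_graph T \<and> Digraph_Component.connected (with_proj T) \<and>
     \<not> (\<exists>p. pre_digraph.cycle (with_proj T) p \<and> length p \<ge> 3)"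

definition S_tree :: "'a pair_pre_digraph \<Rightarrow> 'a set \<Rightarrow> 'a pair_pre_digraph \<Rightarrow> bool" where
  "S_tree G S T \<longleftrightarrow>
     undirected_tree T \<and> subgraph (with_proj T) (with_proj G) \<and> S \<subseteq> pverts T"

text \<open>
  The trees are symmetric, so disjointness of their arc sets is disjointness of their
  edge sets.
\<close>

definition internally_edge_disjoint ::
    "'a set \<Rightarrow> nat \<Rightarrow> (nat \<Rightarrow> 'a pair_pre_digraph) \<Rightarrow> bool" where
  "internally_edge_disjoint S r T \<longleftrightarrow>
     (\<forall>i<r. \<forall>j<r. i \<noteq> j \<longrightarrow>
        pverts (T i) \<inter> pverts (T j) = S \<and> parcs (T i) \<inter> parcs (T j) = {})"

definition S_connectivity :: "'a pair_pre_digraph \<Rightarrow> 'a set \<Rightarrow> nat" where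
  "S_connectivity G S =
     Max {r. \<exists>T. (\<forall>i<r. S_tree G S (T i)) \<and> internally_edge_disjoint S r T}"

definition generalized_connectivity :: "nat \<Rightarrow> 'a pair_pre_digraph \<Rightarrow> nat" where
  "generalized_connectivity k G =
     Min {S_connectivity G S | S. S \<subseteq> pverts G \<and> card S = k}"

section \<open>Well-definedness\<close>

lemma length_signed_permutations:
  assumes "x \<in> signed_permutations n"
  shows "length x = n"
proof -
  have "length (map abs x) = card (set (map abs x))"
    using assms distinct_card[of "map abs x"]
    by (simp add: signed_permutations_def permutations_of_set_def)
  also have "\<dots> = n"
    using assms by (simp add: signed_permutations_def permutations_of_set_def)
  finally show ?thesis by simp
qed

lemma finite_signed_permutations: "finite (signed_permutations n)"
proof (rule finite_subset)
  show "signed_permutations n \<subseteq> {x. set x \<subseteq> {- int n..int n} \<and> length x = n}"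
  proof safe
    fix x a assume x: "x \<in> signed_permutations n"
    then show "length x = n" by (rule length_signed_permutations)
    assume "a \<in> set x"
    then have "abs a \<in> {1..int n}"
      using x by (auto simp: signed_permutations_def permutations_of_set_def)
    then show "a \<in> {- int n..int n}" by auto
  qed
  show "finite {x. set x \<subseteq> {- int n..int n} \<and> length x = n}"
    by (rule finite_lists_length_eq) simp
qed

lemma signed_prefix_reversal_involution:
  assumes "i \<le> length x"
  shows "signed_prefix_reversal i (signed_prefix_reversal i x) = x"
proof -
  have "length (map uminus (rev (take i x))) = i" using assms by simp
  then have "take i (signed_prefix_reversal i x) = map uminus (rev (take i x))"
    and "drop i (signed_prefix_reversal i x) = drop i x"
    unfolding signed_prefix_reversal_def by (metis append_eq_conv_conj)+
  then have "signed_prefix_reversal i (signed_prefix_reversal i x)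
      = map uminus (rev (map uminus (rev (take i x)))) @ drop i x"
    by (simp only: signed_prefix_reversal_def[of i "signed_prefix_reversal i x"])
  also have "map uminus (rev (map uminus (rev (take i x)))) = take i x"
    by (simp only: rev_map rev_rev_ident map_map comp_def minus_minus list.map_ident)
  finally show ?thesis by simp
qed

lemma signed_prefix_reversal_neq:
  assumes "x \<in> signed_permutations n" "i \<in> {1..n}"
  shows "signed_prefix_reversal i x \<noteq> x"
proof
  assume eq: "signed_prefix_reversal i x = x"
  have len: "length x = n" and d: "distinct (map abs x)" and s: "abs ` set x = {1..int n}"
    using assms(1) length_signed_permutations
    by (auto simp: signed_permutations_def permutations_of_set_def)
  have i: "0 < i" "i \<le> n" using assms(2) by auto
  have "x ! 0 = signed_prefix_reversal i x ! 0" using eq by simp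
  also have "\<dots> = - (x ! (i - 1))"
    using i len by (simp add: signed_prefix_reversal_def nth_append rev_nth)
  finally have x0: "x ! 0 = - (x ! (i - 1))" .
  then have "map abs x ! 0 = map abs x ! (i - 1)" using i len by simp
  then have "i - 1 = 0" using d i len nth_eq_iff_index_eq[OF d, of 0 "i - 1"] by simp
  with x0 have "x ! 0 = 0" by simp
  then have "0 \<in> abs ` set x" using i len by (metis abs_0 image_eqI le_trans nth_mem
      not_le le_zero_eq)
  then show False using s by simp
qed

lemma pair_graph_burnt_pancake: "pair_graph (burnt_pancake n)"
proof
  show "finite (pverts (burnt_pancake n))"
    by (simp add: burnt_pancake_def finite_signed_permutations)
  show "finite (parcs (burnt_pancake n))"
    by (rule finite_subset[of _ "signed_permutations n \<times> signed_permutations n"])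
       (auto simp: burnt_pancake_def finite_signed_permutations)
  show "symmetric (with_proj (burnt_pancake n))"
    unfolding symmetric_def with_proj_simps
  proof (rule symI)
    fix x y assume "(x, y) \<in> parcs (burnt_pancake n)"
    then obtain i where i: "x \<in> signed_permutations n" "y \<in> signed_permutations n"
      "i \<in> {1..n}" and y: "y = signed_prefix_reversal i x"
      by (auto simp: burnt_pancake_def)
    have "signed_prefix_reversal i y = x"
      unfolding y using i by (simp add: signed_prefix_reversal_involution length_signed_permutations)
    then have "\<exists>i\<in>{1..n}. x = signed_prefix_reversal i y"
      using i(3) by blast
    with i(1,2) show "(y, x) \<in> parcs (burnt_pancake n)"
      by (simp add: burnt_pancake_def)
  qed
next
  fix e assume e: "e \<in> parcs (burnt_pancake n)"
  then show "fst e \<in> pverts (burnt_pancake n)" "snd e \<in> pverts (burnt_pancake n)"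
    by (auto simp: burnt_pancake_def)
  from e obtain i where i: "fst e \<in> signed_permutations n" "i \<in> {1..n}"
    "snd e = signed_prefix_reversal i (fst e)"
    by (auto simp: burnt_pancake_def)
  then show "fst e \<noteq> snd e"
    using signed_prefix_reversal_neq[OF i(1,2)] by simp
qed

lemma S_tree_arcs_nonempty:
  assumes "S_tree G S T" "card S \<ge> 2"
  shows "parcs T \<noteq> {}"
proof
  assume e: "parcs T = {}"
  have "finite S" using assms(2) card.infinite[of S] by fastforce
  then obtain u v where uv: "u \<in> S" "v \<in> S" "u \<noteq> v"
    using assms(2) card_le_Suc0_iff_eq[of S] by fastforce
  have "mk_symmetric (with_proj T) = \<lparr>pverts = pverts T, parcs = {}\<rparr>"
    using e by (simp add: mk_symmetric_def)
  moreover have "u \<rightarrow>\<^sup>*\<^bsub>with_proj (mk_symmetric (with_proj T))\<^esub> v"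
    using assms(1) uv
    by (auto simp: S_tree_def undirected_tree_def Digraph_Component.connected_def
        strongly_connected_def mk_symmetric_def)
  ultimately have "(u, v) \<in> rtrancl_on (pverts T) {}"
    by (simp add: reachable_def)
  then show False using uv(3) by (cases rule: rtrancl_on.cases) auto
qed

text \<open>The maximum in \<^const>\<open>S_connectivity\<close> and the minimum in
  \<^const>\<open>generalized_connectivity\<close> range over finite nonempty sets.\<close>

lemma S_connectivity_finite:
  assumes "pair_graph G" "card S \<ge> 2"
  shows "finite {r. \<exists>T. (\<forall>i<r. S_tree G S (T i)) \<and> internally_edge_disjoint S r T}"
    and "0 \<in> {r. \<exists>T. (\<forall>i<r. S_tree G S (T i)) \<and> internally_edge_disjoint S r T}"
proof -
  let ?A = "{r. \<exists>T. (\<forall>i<r. S_tree G S (T i)) \<and> internally_edge_disjoint S r T}"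
  have fin: "finite (parcs G)"
    using assms(1) unfolding pair_graph_def pair_digraph_def pair_fin_digraph_def
      pair_fin_digraph_axioms_def by blast
  have "r \<le> card (parcs G)" if "r \<in> ?A" for r
  proof -
    from that obtain T where T: "\<And>i. i < r \<Longrightarrow> S_tree G S (T i)"
      and dis: "internally_edge_disjoint S r T" by blast
    have "\<forall>i\<in>{..<r}. \<exists>e. e \<in> parcs (T i)"
      using S_tree_arcs_nonempty[OF T assms(2)] by blast
    then obtain e where e: "\<And>i. i < r \<Longrightarrow> e i \<in> parcs (T i)"
      by (metis lessThan_iff)
    have "inj_on e {..<r}"
    proof (rule inj_onI, rule ccontr)
      fix i j assume ij: "i \<in> {..<r}" "j \<in> {..<r}" "e i = e j" "i \<noteq> j"
      then have "parcs (T i) \<inter> parcs (T j) = {}"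
        using dis by (auto simp: internally_edge_disjoint_def)
      with e[of i] e[of j] ij show False by auto
    qed
    moreover have "e ` {..<r} \<subseteq> parcs G"
      using e T by (fastforce simp: S_tree_def subgraph_def)
    ultimately show ?thesis
      using card_inj_on_le[OF _ _ fin, of e "{..<r}"] by simp
  qed
  then show "finite ?A" by (meson finite_nat_set_iff_bounded_le)
  show "0 \<in> ?A" by (simp add: internally_edge_disjoint_def)
qed

lemma generalized_connectivity_finite:
  assumes "pair_graph G" "k \<le> card (pverts G)"
  shows "finite {S_connectivity G S | S. S \<subseteq> pverts G \<and> card S = k}"
    and "{S_connectivity G S | S. S \<subseteq> pverts G \<and> card S = k} \<noteq> {}"
proof -
  have "finite (pverts G)"
    using assms(1) unfolding pair_graph_def pair_digraph_def pair_fin_digraph_def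
      pair_fin_digraph_axioms_def by blast
  then have "finite {S. S \<subseteq> pverts G \<and> card S = k}" by simp
  then show "finite {S_connectivity G S | S. S \<subseteq> pverts G \<and> card S = k}"
    by simp
  obtain S where "S \<subseteq> pverts G" "card S = k"
    by (rule obtain_subset_with_card_n[OF assms(2)])
  then have "S_connectivity G S \<in> {S_connectivity G S | S. S \<subseteq> pverts G \<and> card S = k}"
    by blast
  then show "{S_connectivity G S | S. S \<subseteq> pverts G \<and> card S = k} \<noteq> {}"
    by (metis empty_iff)
qed

end

theory Submission
  imports Defs
begin

text \<open>
  Sorting the vertices by their last symbol splits \<open>BP\<^sub>n\<close> into \<open>2n\<close> parts, each a copy of
  \<open>BP\<^sub>n\<^sub>-\<^sub>1\<close>.  The full reversal gives every vertex exactly one neighbour outside its part, and two parts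
  whose symbols differ in absolute value are joined by at least \<open>n - 1\<close> disjoint edges.  Hence, by
  induction, \<open>BP\<^sub>n\<close> is \<open>n\<close>-connected and every sufficiently mixed union of parts is \<open>(n-1)\<close>-connected.

  Lower bound, by induction on \<open>n\<close>: three vertices in one part have \<open>n - 2\<close> trees there, and one more
  through the other parts.  Otherwise choose two of the vertices, \<open>x\<close> and \<open>y\<close>, either in one part or in two
  parts of different absolute value and not adjacent.  Let \<open>A\<close> be the union of the one or two parts
  containing them.  By Menger's theorem there are \<open>n - 1\<close> disjoint paths from \<open>x\<close> to \<open>y\<close> in \<open>A\<close>; leaving \<open>A\<close>
  once from each path and joining the entry points to \<open>z\<close> by a fan outside \<open>A\<close> gives \<open>n - 1\<close> trees.

  Upper bound: with \<open>x\<close> and \<open>y\<close> adjacent, \<open>n\<close> trees would use each edge at \<open>x\<close> and at \<open>y\<close> exactly once,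
  so that the tree containing the edge \<open>xy\<close> could not reach \<open>z\<close>.
\<close>

section \<open>Menger's theorem\<close>

text \<open>The case that shapes the lower bound is that of three different last symbols. No part
  then holds two of the vertices, so \<open>A\<close> has to be a union of two parts. Opposite
  symbols \<open>a\<close> and \<open>- a\<close> are excluded because no edge joins their parts, so
  the union would be disconnected. In a union of two parts the external neighbour of a vertex may
  lie in \<open>A\<close> again, and a path may thus offer no exit into the complement. The
  neighbours of \<open>x\<close> with this defect are so few that at most one of the disjoint paths
  is affected; that one is left through \<open>x\<close> or \<open>y\<close> itself. If
  \<open>y\<close> were the external neighbour of \<open>x\<close>, the edge \<open>xy\<close> would
  be a path without any exit, which is why the pair must be non-adjacent.

  Connected arc sets stand in for trees until the end, where spanning trees are extracted. The
  induction runs over all finite alphabets of positive integers, not only over initial segments: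
  dropping the common last symbol of a part removes one absolute value from the alphabet, and no
  renaming of symbols has to be carried along.\<close>

definition walk_between :: "('a \<times> 'a) set \<Rightarrow> 'a set \<Rightarrow> 'a set \<Rightarrow> 'a list \<Rightarrow> bool" where
  "walk_between R A B p \<longleftrightarrow>
     p \<noteq> [] \<and> successively (\<lambda>u v. (u, v) \<in> R) p \<and> hd p \<in> A \<and> last p \<in> B"

lemma walk_between_mono:
  "walk_between R A B p \<Longrightarrow> R \<subseteq> R' \<Longrightarrow> A \<subseteq> A' \<Longrightarrow> B \<subseteq> B' \<Longrightarrow> walk_between R' A' B' p"
  unfolding walk_between_def by (auto elim!: successively_mono)

lemma walk_between_append:
  "walk_between R A {u} p \<Longrightarrow> walk_between R {v} B q \<Longrightarrow> (u, v) \<in> R \<Longrightarrow> walk_between R A B (p @ q)"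
  unfolding walk_between_def by (auto simp: successively_append_iff)

text \<open>Read from right to left, this splices a walk ending in \<open>v\<close> with one
  starting in \<open>v\<close> without doubling \<open>v\<close>.\<close>

lemma walk_between_split:
  "walk_between R A C (p1 @ v # p2) \<longleftrightarrow>
     walk_between R A {v} (p1 @ [v]) \<and> walk_between R {v} C (v # p2)"
proof -
  have "successively P (p1 @ v # p2) \<longleftrightarrow> successively P (p1 @ [v]) \<and> successively P (v # p2)" for P
    by (simp only: successively_append_iff) auto
  moreover have "hd (p1 @ v # p2) = hd (p1 @ [v])" by (cases p1) simp_all
  moreover have "last (p1 @ v # p2) = last (v # p2)" by (simp only: last_append) simp
  ultimately show ?thesis unfolding walk_between_def by auto
qed

text \<open>Walks may repeat vertices, so even a walk ending in \<open>X\<close> can meet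
  \<open>X\<close> earlier. Cutting at the first such vertex leaves only the final position in
  \<open>X\<close>.\<close>

lemma walk_between_first_hit:
  assumes "walk_between R A B p" "set p \<inter> X \<noteq> {}"
  obtains q where "walk_between R A X q" "set q \<subseteq> set p" "set (butlast q) \<inter> X = {}"
proof -
  from assms(2) have "\<exists>v\<in>set p. v \<in> X" by blast
  then obtain p1 v p2 where p: "p = p1 @ v # p2" "v \<in> X" "\<forall>u\<in>set p1. u \<notin> X"
    by (elim split_list_first_propE)
  have "walk_between R A X (p1 @ [v])"
    using assms(1) p(1,2) unfolding walk_between_split[of _ _ _ p1 v p2] p(1)
    by (auto elim!: walk_between_mono)
  then show thesis using that[of "p1 @ [v]"] p by auto
qed

lemma walk_between_last_hit:
  assumes "walk_between R A B p" "set p \<inter> X \<noteq> {}"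
  obtains q where "walk_between R X B q" "set q \<subseteq> set p" "set (tl q) \<inter> X = {}"
proof -
  from assms(2) have "\<exists>v\<in>set p. v \<in> X" by blast
  then obtain p1 v p2 where p: "p = p1 @ v # p2" "v \<in> X" "\<forall>u\<in>set p2. u \<notin> X"
    by (elim split_list_last_propE)
  have "walk_between R X B (v # p2)"
    using assms(1) p(1,2) unfolding walk_between_split[of _ _ _ p1 v p2] p(1)
    by (auto elim!: walk_between_mono)
  then show thesis using that[of "v # p2"] p by auto
qed

text \<open>The arc \<open>(x, y)\<close> can be traversed only from a non-final position that holds
  \<open>x\<close>.\<close>

lemma successively_avoid_tail:
  assumes "successively (\<lambda>u v. (u, v) \<in> R) p" "x \<notin> set (butlast p)"
  shows "successively (\<lambda>u v. (u, v) \<in> R - {(x, y)}) p"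
  using assms by (induction p rule: induct_list012) auto

lemma successively_avoid_head:
  assumes "successively (\<lambda>u v. (u, v) \<in> R) p" "y \<notin> set (tl p)"
  shows "successively (\<lambda>u v. (u, v) \<in> R - {(x, y)}) p"
  using assms by (induction p rule: induct_list012) auto

lemma bij_betw_inj_card:
  assumes "inj_on f P" "f ` P \<subseteq> X" "finite X" "card P = card X"
  shows "bij_betw f P X"
  using assms by (simp add: bij_betw_def card_image card_subset_eq)

text \<open>
  Induction on the number of arcs.  If deleting the arc \<open>(x, y)\<close> destroys the bound, some \<open>S\<close> with
  \<open>k - 1\<close> elements separates \<open>A\<close> from \<open>B\<close> in the remaining graph.  There, \<open>k\<close> disjoint walks lead from
  \<open>A\<close> to \<open>insert x S\<close> and \<open>k\<close> others from \<open>insert y S\<close> to \<open>B\<close>; they meet only in \<open>S\<close> and are joined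
  there and along \<open>(x, y)\<close>.
\<close>
theorem menger:
  assumes "finite R" "finite A"
    and "\<And>T. finite T \<Longrightarrow> (\<And>p. walk_between R A B p \<Longrightarrow> set p \<inter> T \<noteq> {}) \<Longrightarrow> k \<le> card T"
  shows "\<exists>P. finite P \<and> card P = k \<and> (\<forall>p\<in>P. walk_between R A B p) \<and>
             pairwise (\<lambda>p q. set p \<inter> set q = {}) P"
  using assms
proof (induction "card R" arbitrary: R A B rule: less_induct)
  case less
  note sep = less.prems(3)
  show ?case
  proof (cases "R = {}")
    case True
    \<comment> \<open>Without arcs every walk is a single vertex, so \<open>A \<inter> B\<close>
      itself separates.\<close>
    have "k \<le> card (A \<inter> B)"
    proof (rule sep)
      fix p assume "walk_between R A B p"
      then have "p \<noteq> []" "successively (\<lambda>u v. False) p" "hd p \<in> A" "last p \<in> B"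
        unfolding walk_between_def True by auto
      then show "set p \<inter> (A \<inter> B) \<noteq> {}"
        by (cases p; cases "tl p") auto
    qed (use less.prems in auto)
    then obtain X where X: "X \<subseteq> A \<inter> B" "card X = k" "finite X"
      using obtain_subset_with_card_n by metis
    show ?thesis
    proof (intro exI[of _ "(\<lambda>v. [v]) ` X"] conjI)
      show "card ((\<lambda>v. [v]) ` X) = k" using X by (subst card_image) (auto simp: inj_on_def)
    qed (use X in \<open>auto simp: walk_between_def pairwise_def\<close>)
  next
    case False
    then obtain x y where xy: "(x, y) \<in> R" by auto
    let ?R = "R - {(x, y)}"
    have smaller: "card ?R < card R" using xy less.prems(1) by (rule_tac card_Diff1_less)
    have finR: "finite ?R" using less.prems(1) by simp
    show ?thesis
    proof (cases "\<forall>T. finite T \<longrightarrow> (\<forall>p. walk_between ?R A B p \<longrightarrow> set p \<inter> T \<noteq> {}) \<longrightarrow> k \<le> card T")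
      case True
      then have "\<exists>P. finite P \<and> card P = k \<and> (\<forall>p\<in>P. walk_between ?R A B p) \<and>
             pairwise (\<lambda>p q. set p \<inter> set q = {}) P"
        by (intro less.hyps[OF smaller finR less.prems(2)]) simp
      then obtain P where "finite P" "card P = k" "\<forall>p\<in>P. walk_between ?R A B p"
        "pairwise (\<lambda>p q. set p \<inter> set q = {}) P" by (elim exE conjE)
      moreover from this(3) have "\<forall>p\<in>P. walk_between R A B p"
        using walk_between_mono[of ?R A B _ R A B] by blast
      ultimately show ?thesis by (intro exI[of _ P] conjI)
    next
      case False
      then obtain S where S: "finite S" "card S < k"
        and Ssep: "\<And>p. walk_between ?R A B p \<Longrightarrow> set p \<inter> S \<noteq> {}"
        unfolding not_all not_imp not_le by blast
      let ?X = "insert x S" and ?Y = "insert y S"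
      \<comment> \<open>A walk traversing the deleted arc contains both \<open>x\<close> and
        \<open>y\<close>; any other walk survives in \<open>?R\<close> and meets
        \<open>S\<close>.\<close>
      have meets: "set p \<inter> ?X \<noteq> {} \<and> set p \<inter> ?Y \<noteq> {}" if p: "walk_between R A B p" for p
      proof (cases "x \<in> set (butlast p) \<and> y \<in> set (tl p)")
        case True
        then have "x \<in> set p" "y \<in> set p"
          using in_set_butlastD[of x p] list.set_sel(2)[of p y] by (cases "p = []"; simp)+
        then show ?thesis by blast
      next
        case False
        then have "successively (\<lambda>u v. (u, v) \<in> ?R) p"
          using p successively_avoid_tail[of R p x y] successively_avoid_head[of R p y x]
          unfolding walk_between_def by blast
        then have "walk_between ?R A B p" using p unfolding walk_between_def by blast
        then show ?thesis using Ssep by blast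
      qed
      have kX: "k \<le> card ?X" by (rule sep) (use S meets in auto)
      have kY: "k \<le> card ?Y" by (rule sep) (use S meets in auto)
      have xS: "x \<notin> S" and yS: "y \<notin> S" using kX kY S by (auto simp: insert_absorb)
      have cX: "card ?X = k" and cY: "card ?Y = k" using kX kY S xS yS by auto

      \<comment> \<open>A walk cut at its first vertex of \<open>?X\<close> has \<open>x\<close> at
        most at its end. It therefore avoids the deleted arc, and \<open>T\<close> must meet
        it.\<close>
      have k1: "k \<le> card T" if T: "finite T" "\<And>p. walk_between ?R A ?X p \<Longrightarrow> set p \<inter> T \<noteq> {}" for T
      proof (rule sep[OF T(1)])
        fix p assume p: "walk_between R A B p"
        then obtain q where q: "walk_between R A ?X q" "set q \<subseteq> set p" "set (butlast q) \<inter> ?X = {}"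
          using walk_between_first_hit[of R A B p ?X] meets by blast
        then have "walk_between ?R A ?X q"
          using successively_avoid_tail[of R q x y] unfolding walk_between_def by blast
        then show "set p \<inter> T \<noteq> {}" using T(2) q(2) by blast
      qed
      have "\<exists>P. finite P \<and> card P = k \<and> (\<forall>p\<in>P. walk_between ?R A ?X p) \<and>
             pairwise (\<lambda>p q. set p \<inter> set q = {}) P"
        by (rule less.hyps[OF smaller finR]; (rule k1)?) (use S(1) less.prems(2) in auto)
      then obtain P1' where P1': "finite P1'" "card P1' = k" "\<forall>p\<in>P1'. walk_between ?R A ?X p"
             "pairwise (\<lambda>p q. set p \<inter> set q = {}) P1'"
        by (elim exE conjE)
      have k2: "k \<le> card T" if T: "finite T" "\<And>p. walk_between ?R ?Y B p \<Longrightarrow> set p \<inter> T \<noteq> {}" for T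
      proof (rule sep[OF T(1)])
        fix p assume p: "walk_between R A B p"
        then obtain q where q: "walk_between R ?Y B q" "set q \<subseteq> set p" "set (tl q) \<inter> ?Y = {}"
          using walk_between_last_hit[of R A B p ?Y] meets by blast
        then have "walk_between ?R ?Y B q"
          using successively_avoid_head[of R q y x] unfolding walk_between_def by blast
        then show "set p \<inter> T \<noteq> {}" using T(2) q(2) by blast
      qed
      have "\<exists>P. finite P \<and> card P = k \<and> (\<forall>p\<in>P. walk_between ?R ?Y B p) \<and>
             pairwise (\<lambda>p q. set p \<inter> set q = {}) P"
        by (rule less.hyps[OF smaller finR]; (rule k2)?) (use S(1) less.prems(2) in auto)
      then obtain P2' where P2': "finite P2'" "card P2' = k" "\<forall>p\<in>P2'. walk_between ?R ?Y B p"
             "pairwise (\<lambda>p q. set p \<inter> set q = {}) P2'"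
        by (elim exE conjE)

      have "inj_on last P1'"
        using P1'(3,4) unfolding inj_on_def pairwise_def walk_between_def
        by (metis IntI empty_iff last_in_set)
      moreover have "last ` P1' \<subseteq> ?X" using P1'(3) by (auto simp: walk_between_def)
      ultimately have b1: "bij_betw last P1' ?X"
        using cX P1' S(1) by (intro bij_betw_inj_card) auto
      have "inj_on hd P2'"
        using P2'(3,4) unfolding inj_on_def pairwise_def walk_between_def
        by (metis IntI empty_iff hd_in_set)
      moreover have "hd ` P2' \<subseteq> ?Y" using P2'(3) by (auto simp: walk_between_def)
      ultimately have b2: "bij_betw hd P2' ?Y"
        using cY P2' S(1) by (intro bij_betw_inj_card) auto
      define f where "f = inv_into P1' last"
      define g where "g = inv_into P2' hd"
      have f: "f s \<in> P1'" "last (f s) = s" if "s \<in> ?X" for s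
        using that b1 unfolding f_def bij_betw_def
        by (metis inv_into_into, metis f_inv_into_f)
      have g: "g s \<in> P2'" "hd (g s) = s" if "s \<in> ?Y" for s
        using that b2 unfolding g_def bij_betw_def
        by (metis inv_into_into, metis f_inv_into_f)
      \<comment> \<open>Each of the \<open>k\<close> elements of \<open>?X\<close> is the end of its
        own walk, so by disjointness no walk contains a second one.\<close>
      have fX: "set (f s) \<inter> ?X = {s}" if s: "s \<in> ?X" for s
      proof -
        have "t = s" if "t \<in> set (f s)" "t \<in> ?X" for t
        proof (rule ccontr)
          assume "t \<noteq> s"
          then have "f t \<noteq> f s" using f s that by metis
          moreover have "t \<in> set (f t)" using f[OF that(2)] P1'(3)
            unfolding walk_between_def by (metis last_in_set)
          ultimately show False using P1'(4) f s that unfolding pairwise_def by blast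
        qed
        moreover have "s \<in> set (f s)" using f[OF s] P1'(3)
            unfolding walk_between_def by (metis last_in_set)
        ultimately show ?thesis using s by blast
      qed
      have gY: "set (g s) \<inter> ?Y = {s}" if s: "s \<in> ?Y" for s
      proof -
        have "t = s" if "t \<in> set (g s)" "t \<in> ?Y" for t
        proof (rule ccontr)
          assume "t \<noteq> s"
          then have "g t \<noteq> g s" using g s that by metis
          moreover have "t \<in> set (g t)" using g[OF that(2)] P2'(3)
            unfolding walk_between_def by (metis hd_in_set)
          ultimately show False using P2'(4) g s that unfolding pairwise_def by blast
        qed
        moreover have "s \<in> set (g s)" using g[OF s] P2'(3)
            unfolding walk_between_def by (metis hd_in_set)
        ultimately show ?thesis using s by blast
      qed
      \<comment> \<open>A walk may pass through \<open>s\<close> before it ends there. The cut at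
        the first visit keeps every proper initial piece outside \<open>S\<close>, as the splice for
        \<open>pq\<close> requires.\<close>
      have "\<exists>q. walk_between ?R A {s} q \<and> set q \<inter> ?X = {s} \<and> set q \<subseteq> set (f s) \<and> set (butlast q) \<inter> ?X = {}"
        if s: "s \<in> ?X" for s
      proof -
        have "walk_between ?R A ?X (f s)" using f[OF s] P1'(3) by blast
        then obtain q where q: "walk_between ?R A ?X q" "set q \<subseteq> set (f s)" "set (butlast q) \<inter> ?X = {}"
          using walk_between_first_hit[of ?R A ?X "f s" ?X] fX[OF s] by blast
        have "last q \<in> set q \<inter> ?X" using q(1) unfolding walk_between_def by auto
        moreover have "set q \<inter> ?X \<subseteq> {s}" using q(2) fX[OF s] by blast
        ultimately have "last q = s" "set q \<inter> ?X = {s}" by blast+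
        then show ?thesis using q unfolding walk_between_def by blast
      qed
      then obtain p where p: "\<And>s. s \<in> ?X \<Longrightarrow> walk_between ?R A {s} (p s) \<and> set (p s) \<inter> ?X = {s} \<and>
          set (p s) \<subseteq> set (f s) \<and> set (butlast (p s)) \<inter> ?X = {}" by metis
      note p_walk = p[THEN conjunct1] and p_hit = p[THEN conjunct2, THEN conjunct1]
        and p_sub = p[THEN conjunct2, THEN conjunct2, THEN conjunct1]
        and p_but = p[THEN conjunct2, THEN conjunct2, THEN conjunct2]
      have "\<exists>q. walk_between ?R {s} B q \<and> set q \<inter> ?Y = {s} \<and> set q \<subseteq> set (g s) \<and> set (tl q) \<inter> ?Y = {}"
        if s: "s \<in> ?Y" for s
      proof -
        have "walk_between ?R ?Y B (g s)" using g[OF s] P2'(3) by blast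
        then obtain q where q: "walk_between ?R ?Y B q" "set q \<subseteq> set (g s)" "set (tl q) \<inter> ?Y = {}"
          using walk_between_last_hit[of ?R ?Y B "g s" ?Y] gY[OF s] by blast
        have "hd q \<in> set q \<inter> ?Y" using q(1) unfolding walk_between_def by auto
        moreover have "set q \<inter> ?Y \<subseteq> {s}" using q(2) gY[OF s] by blast
        ultimately have "hd q = s" "set q \<inter> ?Y = {s}" by blast+
        then show ?thesis using q unfolding walk_between_def by blast
      qed
      then obtain q where q: "\<And>s. s \<in> ?Y \<Longrightarrow> walk_between ?R {s} B (q s) \<and> set (q s) \<inter> ?Y = {s} \<and>
          set (q s) \<subseteq> set (g s) \<and> set (tl (q s)) \<inter> ?Y = {}" by metis
      note q_walk = q[THEN conjunct1] and q_hit = q[THEN conjunct2, THEN conjunct1]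
        and q_sub = q[THEN conjunct2, THEN conjunct2, THEN conjunct1]
        and q_tl = q[THEN conjunct2, THEN conjunct2, THEN conjunct2]
      have pp: "set (p s) \<inter> set (p t) = {}" if "s \<in> ?X" "t \<in> ?X" "s \<noteq> t" for s t
      proof -
        have "f s \<noteq> f t" using f(2)[OF that(1)] f(2)[OF that(2)] that(3) by auto
        then have "set (f s) \<inter> set (f t) = {}"
          using pairwiseD[OF P1'(4) f(1)[OF that(1)] f(1)[OF that(2)]] by simp
        moreover have "set (p s) \<subseteq> set (f s)" "set (p t) \<subseteq> set (f t)"
          using p_sub that by simp_all
        ultimately show ?thesis by blast
      qed
      have qq: "set (q s) \<inter> set (q t) = {}" if "s \<in> ?Y" "t \<in> ?Y" "s \<noteq> t" for s t
      proof -
        have "g s \<noteq> g t" using g(2)[OF that(1)] g(2)[OF that(2)] that(3) by auto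
        then have "set (g s) \<inter> set (g t) = {}"
          using pairwiseD[OF P2'(4) g(1)[OF that(1)] g(1)[OF that(2)]] by simp
        moreover have "set (q s) \<subseteq> set (g s)" "set (q t) \<subseteq> set (g t)"
          using q_sub that by simp_all
        ultimately show ?thesis by blast
      qed
      \<comment> \<open>At a common vertex outside \<open>S\<close>, the beginning of
        \<open>p s\<close> and the end of \<open>q t\<close> would splice to a walk of
        \<open>?R\<close> from \<open>A\<close> to \<open>B\<close> that avoids
        \<open>S\<close>.\<close>
      have pq: "v \<in> S" if st: "s \<in> ?X" "t \<in> ?Y" and v: "v \<in> set (p s)" "v \<in> set (q t)" for s t v
      proof (rule ccontr)
        assume vS: "v \<notin> S"
        obtain p1 p2 where ps: "p s = p1 @ v # p2" using v(1) by (meson split_list)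
        obtain q1 q2 where qt: "q t = q1 @ v # q2" using v(2) by (meson split_list)
        have "walk_between ?R A {s} (p1 @ v # p2)" "walk_between ?R {t} B (q1 @ v # q2)"
          using p_walk[OF st(1)] q_walk[OF st(2)] by (simp_all only: ps qt)
        then have "walk_between ?R A {v} (p1 @ [v])" "walk_between ?R {v} B (v # q2)"
          using walk_between_split[of ?R A "{s}" p1 v p2] walk_between_split[of ?R "{t}" B q1 v q2]
          by simp_all
        then have "walk_between ?R A B (p1 @ v # q2)"
          using walk_between_split[of ?R A B p1 v q2] by simp
        then have "set (p1 @ v # q2) \<inter> S \<noteq> {}" by (rule Ssep)
        moreover have "set p1 \<subseteq> set (butlast (p s))" "set q2 \<subseteq> set (tl (q t))"
          unfolding ps qt by (simp_all add: butlast_append) (cases q1; auto)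
        then have "set p1 \<inter> S = {}" "set q2 \<inter> S = {}"
          using p_but[OF st(1)] q_tl[OF st(2)] by blast+
        ultimately show False using vS by auto
      qed
      \<comment> \<open>Ends in \<open>?X\<close> are matched with starts in \<open>?Y\<close>:
        \<open>x\<close> goes to \<open>y\<close> along the restored arc. An element of
        \<open>S\<close> is both an end and a start, and \<open>tl\<close> keeps it from occurring
        twice.\<close>
      define h where "h s = (if s = x then y else s)" for s
      define c where "c s = (if s = x then p s @ q y else p s @ tl (q s))" for s
      have hY: "h s \<in> ?Y" if "s \<in> ?X" for s using that by (auto simp: h_def)
      have hinj: "h s \<noteq> h t" if "s \<in> ?X" "t \<in> ?X" "s \<noteq> t" for s t
        using that yS by (auto simp: h_def)
      have cset: "set (c s) \<subseteq> set (p s) \<union> set (q (h s))" for s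
        using list.set_sel(2)[of "q s"] by (cases "q s") (auto simp: c_def h_def)
      have cwalk: "walk_between R A B (c s)" if s: "s \<in> ?X" for s
      proof (cases "s = x")
        case True
        have "walk_between R A {x} (p x)" "walk_between R {y} B (q y)"
          using walk_between_mono[OF p_walk[of x], of R] walk_between_mono[OF q_walk[of y], of R]
          by simp_all
        then have "walk_between R A B (p x @ q y)" using xy by (rule walk_between_append)
        then show ?thesis unfolding c_def using True by simp
      next
        case False
        then have sS: "s \<in> ?Y" using s by auto
        have w: "walk_between R A {s} (p s)" "walk_between R {s} B (q s)"
          using walk_between_mono[OF p_walk[OF s], of R] walk_between_mono[OF q_walk[OF sS], of R]
          by simp_all
        have "p s = butlast (p s) @ [s]"
          using w(1) append_butlast_last_id[of "p s"] unfolding walk_between_def by simp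
        then obtain p' where ps: "p s = p' @ [s]" by blast
        have "q s = s # tl (q s)"
          using w(2) list.collapse[of "q s"] unfolding walk_between_def by simp
        then obtain q' where qs: "q s = s # q'" by blast
        have "walk_between R A B (p' @ s # q')"
          using w walk_between_split[of R A B p' s q'] by (simp add: ps qs)
        moreover have "p' @ s # q' = c s"
          using False by (simp add: c_def ps qs)
        ultimately show ?thesis by simp
      qed
      have cdisj: "set (c s) \<inter> set (c t) = {}" if st: "s \<in> ?X" "t \<in> ?X" "s \<noteq> t" for s t
      proof -
        \<comment> \<open>A common vertex lies in \<open>S\<close> and equals both \<open>s\<close>
          and \<open>h t\<close>. As \<open>y\<close> is not in \<open>S\<close>, this forces
          \<open>h t = t\<close>, so \<open>s = t\<close>.\<close>
        have cross: "set (p s) \<inter> set (q (h t)) = {}" if st: "s \<in> ?X" "t \<in> ?X" "s \<noteq> t" for s t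
        proof -
          have False if v: "v \<in> set (p s)" "v \<in> set (q (h t))" for v
          proof -
            have "v \<in> S" by (rule pq[OF st(1) hY[OF st(2)] v])
            then have "v = s" "v = h t" using p_hit[OF st(1)] q_hit[OF hY[OF st(2)]] v by blast+
            then show False using st \<open>v \<in> S\<close> yS by (auto simp: h_def split: if_splits)
          qed
          then show ?thesis by blast
        qed
        show ?thesis
          using cset[of s] cset[of t] pp[OF st] qq[OF hY[OF st(1)] hY[OF st(2)] hinj[OF st]]
            cross[OF st] cross[OF st(2) st(1)] st(3) by blast
      qed
      have "inj_on c ?X"
      proof (rule inj_onI, rule ccontr)
        fix s t assume "s \<in> ?X" "t \<in> ?X" "c s = c t" "s \<noteq> t"
        then show False using cdisj[of s t] cwalk[of s] by (auto simp: walk_between_def)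
      qed
      then have "card (c ` ?X) = k" using cX by (simp only: card_image)
      then show ?thesis
        using cwalk cdisj S(1) by (intro exI[of _ "c ` ?X"] conjI) (auto simp: pairwise_def)
    qed
  qed
qed

section \<open>Connectivity, fans and disjoint walks\<close>

text \<open>Connectedness of the induced subgraph. Intersecting with \<open>W \<times> W\<close>
  lets one ambient relation serve all vertex sets; the empty set counts as connected.\<close>

definition conn_on :: "('a \<times> 'a) set \<Rightarrow> 'a set \<Rightarrow> bool" where
  "conn_on E W \<longleftrightarrow> (\<forall>u\<in>W. \<forall>v\<in>W. (u, v) \<in> (E \<inter> W \<times> W)\<^sup>*)"

lemma conn_onD: "conn_on E W \<Longrightarrow> u \<in> W \<Longrightarrow> v \<in> W \<Longrightarrow> (u, v) \<in> (E \<inter> W \<times> W)\<^sup>*"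
  by (simp add: conn_on_def)

lemma conn_on_rtrancl:
  assumes "conn_on E W" "W \<subseteq> W'" "u \<in> W" "v \<in> W"
  shows "(u, v) \<in> (E \<inter> W' \<times> W')\<^sup>*"
  using conn_onD[OF assms(1,3,4)] rtrancl_mono[of "E \<inter> W \<times> W" "E \<inter> W' \<times> W'"] assms(2) by blast

lemma conn_on_hubI:
  assumes "sym E" "\<And>u. u \<in> W \<Longrightarrow> (c, u) \<in> (E \<inter> W \<times> W)\<^sup>*"
  shows "conn_on E W"
proof -
  have "sym (E \<inter> W \<times> W)" using assms(1) by (auto simp: sym_def)
  then have "sym ((E \<inter> W \<times> W)\<^sup>*)" by (rule sym_rtrancl)
  then show ?thesis using assms(2) unfolding conn_on_def by (meson rtrancl_trans symD)
qed

lemma conn_on_empty: "conn_on E {}" by (simp add: conn_on_def)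

lemma conn_on_singleton: "conn_on E {v}" by (simp add: conn_on_def)

lemma conn_on_mono:
  assumes "conn_on E W" "E \<inter> W \<times> W \<subseteq> E'"
  shows "conn_on E' W"
proof -
  have "(E \<inter> W \<times> W)\<^sup>* \<subseteq> (E' \<inter> W \<times> W)\<^sup>*" using assms(2) by (intro rtrancl_mono) blast
  then show ?thesis using assms(1) unfolding conn_on_def by blast
qed

lemma conn_on_Un:
  assumes "sym E" "conn_on E W1" "conn_on E W2" "c \<in> W1" "c \<in> W2"
  shows "conn_on E (W1 \<union> W2)"
  using assms by (intro conn_on_hubI[where c = c]) (auto intro: conn_on_rtrancl)

lemma conn_on_edge:
  assumes "sym E" "(u, v) \<in> E"
  shows "conn_on E {u, v}"
  using assms by (intro conn_on_hubI[where c = u]) auto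

lemma conn_on_edge_Un:
  assumes "sym E" "conn_on E W1" "conn_on E W2" "u \<in> W1" "v \<in> W2" "(u, v) \<in> E"
  shows "conn_on E (W1 \<union> W2)"
proof -
  have "conn_on E (W1 \<union> {u, v})"
    by (rule conn_on_Un[OF assms(1,2) conn_on_edge[OF assms(1,6)], of u]) (use assms in auto)
  then have "conn_on E ((W1 \<union> {u, v}) \<union> W2)"
    by (rule conn_on_Un[OF assms(1) _ assms(3), of _ v]) (use assms in auto)
  moreover have "(W1 \<union> {u, v}) \<union> W2 = W1 \<union> W2" using assms by blast
  ultimately show ?thesis by simp
qed

lemma conn_on_attach:
  assumes "sym E" "conn_on E W" "\<And>x. x \<in> X \<Longrightarrow> \<exists>y\<in>W. (y, x) \<in> E"
  shows "conn_on E (X \<union> W)"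
proof (cases "X \<union> W = {}")
  case True
  then show ?thesis by (simp add: conn_on_empty)
next
  case False
  then obtain c where c: "c \<in> W" using assms(3) by blast
  show ?thesis
  proof (rule conn_on_hubI[OF assms(1)])
    fix u assume "u \<in> X \<union> W"
    then show "(c, u) \<in> (E \<inter> (X \<union> W) \<times> (X \<union> W))\<^sup>*"
    proof
      assume u: "u \<in> X"
      then obtain y where y: "y \<in> W" "(y, u) \<in> E" using assms(3) by blast
      have "(c, y) \<in> (E \<inter> (X \<union> W) \<times> (X \<union> W))\<^sup>*"
        using conn_on_rtrancl[OF assms(2)] c y by blast
      then show ?thesis using y u by (auto intro: rtrancl_into_rtrancl)
    qed (use conn_on_rtrancl[OF assms(2)] c in blast)
  qed
qed

lemma conn_on_walk:
  assumes "sym E" "successively (\<lambda>u v. (u, v) \<in> E) p"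
  shows "conn_on E (set p)"
  using assms(2)
proof (induction p rule: induct_list012)
  case (3 u v p)
  then have "conn_on E ({u} \<union> set (v # p))"
    by (intro conn_on_edge_Un[OF assms(1) conn_on_singleton]) auto
  then show ?case by (simp add: insert_commute)
qed (simp_all add: conn_on_empty conn_on_singleton)

text \<open>\<open>R\<close> relates blocks whose union stays connected after the deletion of
  \<open>F\<close>. Any two blocks are at most two such steps apart, and what is left of the middle
  block supplies a vertex to pass through.\<close>

lemma conn_on_UN:
  assumes "sym E"
    and "\<And>a. a \<in> I \<Longrightarrow> B a - F \<noteq> {}"
    and "\<And>a. a \<in> I \<Longrightarrow> conn_on E (B a - F)"
    and "\<And>a b. a \<in> I \<Longrightarrow> b \<in> I \<Longrightarrow> R a b \<Longrightarrow> conn_on E ((B a \<union> B b) - F)"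
    and "\<And>a b. a \<in> I \<Longrightarrow> b \<in> I \<Longrightarrow> a = b \<or> R a b \<or> (\<exists>c\<in>I. R a c \<and> R c b)"
  shows "conn_on E (\<Union> (B ` I) - F)"
  unfolding conn_on_def
proof (intro ballI)
  let ?W = "\<Union> (B ` I) - F"
  fix u v assume "u \<in> ?W" "v \<in> ?W"
  then obtain a b where ab: "a \<in> I" "b \<in> I" "u \<in> B a - F" "v \<in> B b - F" by blast
  have R: "(s, t) \<in> (E \<inter> ?W \<times> ?W)\<^sup>*"
    if "c \<in> I" "d \<in> I" "R c d" "s \<in> B c - F" "t \<in> B d - F" for s t c d
    by (rule conn_on_rtrancl[OF assms(4)[OF that(1-3)]]) (use that in auto)
  consider "a = b" | "R a b" | c where "c \<in> I" "R a c" "R c b" using assms(5)[OF ab(1,2)] by blast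
  then show "(u, v) \<in> (E \<inter> ?W \<times> ?W)\<^sup>*"
  proof cases
    case 1
    then show ?thesis using ab conn_on_rtrancl[OF assms(3)[OF ab(1)], of ?W u v] by blast
  next
    case 2
    then show ?thesis using R ab by blast
  next
    case 3
    then obtain s where "s \<in> B c - F" using assms(2) by blast
    then have "(u, s) \<in> (E \<inter> ?W \<times> ?W)\<^sup>*" "(s, v) \<in> (E \<inter> ?W \<times> ?W)\<^sup>*"
      using R ab 3 by blast+
    then show ?thesis by (rule rtrancl_trans)
  qed
qed

text \<open>\<open>g\<close> is a matching from \<open>M\<close> into \<open>Y\<close>. A deleted
  vertex destroys at most one matching edge, so fewer deletions than edges leave an edge that joins
  the two sides.\<close>

lemma conn_on_glue:
  assumes "sym E" "conn_on E (X - F)" "conn_on E (Y - F)" "X \<inter> Y = {}" "M \<subseteq> X"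
    and "inj_on g M" "g ` M \<subseteq> Y" "finite F" "card F < card M" "\<And>u. u \<in> M \<Longrightarrow> (u, g u) \<in> E"
  shows "conn_on E ((X \<union> Y) - F)"
proof -
  have "\<exists>u\<in>M. u \<notin> F \<and> g u \<notin> F"
  proof (rule ccontr)
    assume none: "\<not> ?thesis"
    define h where "h u = (if u \<in> F then u else g u)" for u
    have "inj_on h M"
    proof (rule inj_onI)
      fix u v assume uv: "u \<in> M" "v \<in> M" "h u = h v"
      have "u \<in> X" "v \<in> X" "g u \<notin> X" "g v \<notin> X" using uv assms(4,5,7) by blast+
      then show "u = v" using uv inj_onD[OF assms(6), of u v] unfolding h_def by (auto split: if_splits)
    qed
    moreover have "h ` M \<subseteq> F" using none by (auto simp: h_def)
    ultimately have "card M \<le> card F" using assms(8) by (rule card_inj_on_le)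
    then show False using assms(9) by simp
  qed
  then obtain u where u: "u \<in> M" "u \<notin> F" "g u \<notin> F" by blast
  have "conn_on E ((X - F) \<union> (Y - F))"
    by (rule conn_on_edge_Un[OF assms(1-3), of u "g u"]) (use u assms(5,7,10) in auto)
  then show ?thesis by (simp add: Un_Diff)
qed

lemma conn_on_image:
  assumes "conn_on E W" "\<And>u v. u \<in> W \<Longrightarrow> v \<in> W \<Longrightarrow> (u, v) \<in> E \<Longrightarrow> (f u, f v) \<in> E'"
  shows "conn_on E' (f ` W)"
proof -
  have "(f u, f v) \<in> (E' \<inter> f ` W \<times> f ` W)\<^sup>*" if "(u, v) \<in> (E \<inter> W \<times> W)\<^sup>*" for u v
    using that
  proof induction
    case (step v w)
    then have "(f v, f w) \<in> E' \<inter> f ` W \<times> f ` W" using assms(2) by blast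
    with step.IH show ?case by (rule rtrancl_into_rtrancl)
  qed simp
  then show ?thesis using assms(1) unfolding conn_on_def by blast
qed

text \<open>Only the deletion condition is imposed: a complete graph satisfies it for every
  \<open>k\<close>. Bounds on sizes and degrees are therefore supplied separately where they
  matter.\<close>

definition k_connected :: "nat \<Rightarrow> ('a \<times> 'a) set \<Rightarrow> 'a set \<Rightarrow> bool" where
  "k_connected k E X \<longleftrightarrow> (\<forall>F. finite F \<longrightarrow> card F < k \<longrightarrow> conn_on E (X - F))"

lemma k_connectedD: "k_connected k E X \<Longrightarrow> finite F \<Longrightarrow> card F < k \<Longrightarrow> conn_on E (X - F)"
  by (simp add: k_connected_def)

text \<open>The deleted vertices are pulled back along \<open>f\<close>. This moves connectivity
  from a smaller alphabet to a part.\<close>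

lemma k_connected_image:
  assumes "k_connected k E X" "inj_on f X"
    and "\<And>u v. u \<in> X \<Longrightarrow> v \<in> X \<Longrightarrow> (u, v) \<in> E \<Longrightarrow> (f u, f v) \<in> E'"
  shows "k_connected k E' (f ` X)"
  unfolding k_connected_def
proof (intro allI impI)
  fix F :: "'b set" assume F: "finite F" "card F < k"
  define G where "G = {x \<in> X. f x \<in> F}"
  have G: "inj_on f G" "f ` G \<subseteq> F" using assms(2) by (auto simp: G_def inj_on_def)
  have "finite G" using inj_on_finite[OF G F(1)] .
  moreover have "card G < k" using card_inj_on_le[OF G F(1)] F(2) by simp
  ultimately have "conn_on E (X - G)" using assms(1) by (simp add: k_connected_def)
  then have "conn_on E' (f ` (X - G))" by (rule conn_on_image) (use assms(3) in blast)
  moreover have "f ` (X - G) = f ` X - F" by (auto simp: G_def)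
  ultimately show "conn_on E' (f ` X - F)" by simp
qed

section \<open>Fans and disjoint walks from Menger's theorem\<close>

lemma rtrancl_imp_walk:
  assumes "(u, v) \<in> (E \<inter> W \<times> W)\<^sup>*" "u \<in> W"
  obtains p where "walk_between E {u} {v} p" "set p \<subseteq> W"
  using assms
proof (induction arbitrary: thesis)
  case base
  show ?case by (rule base(1)[of "[u]"]) (use base in \<open>auto simp: walk_between_def\<close>)
next
  case (step v w)
  from step.IH step.prems(2) obtain p where p: "walk_between E {u} {v} p" "set p \<subseteq> W" by blast
  have "walk_between E {w} {w} [w]" by (simp add: walk_between_def)
  then have "walk_between E {u} {w} (p @ [w])"
    using walk_between_append[OF p(1)] step.hyps(2) by blast
  then show ?case using step.prems(1) p(2) step.hyps(2) by auto
qed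

text \<open>The cut is made behind the last visit to \<open>x\<close>, so the rest starts at a
  neighbour of \<open>x\<close> and never returns.\<close>

lemma walk_between_leave:
  assumes "walk_between E {x} B p" "x \<notin> B"
  obtains q where "walk_between E (E `` {x}) B q" "set q \<subseteq> set p - {x}"
proof -
  have "x \<in> set p" using assms(1) unfolding walk_between_def by (metis hd_in_set singletonD)
  then obtain p1 q where p: "p = p1 @ x # q" "x \<notin> set q" by (meson split_list_last)
  then have q: "walk_between E {x} B (x # q)" using assms(1) walk_between_split[of E _ B p1 x q] by auto
  then have "q \<noteq> []" using assms(2) by (auto simp: walk_between_def)
  then have "walk_between E (E `` {x}) B q"
    using q by (cases q) (auto simp: walk_between_def)
  then show thesis using that p by auto
qed

lemma walk_between_arrive:
  assumes "walk_between E A {y} p" "y \<notin> A" "sym E"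
  obtains q where "walk_between E A (E `` {y}) q" "set q \<subseteq> set p - {y}"
proof -
  have "y \<in> set p" using assms(1) unfolding walk_between_def by (metis last_in_set singletonD)
  then obtain q p2 where p: "p = q @ y # p2" "y \<notin> set q" by (meson split_list_first)
  then have q: "walk_between E A {y} (q @ [y])" using assms(1) walk_between_split[of E A _ q y p2] by auto
  then have "q \<noteq> []" using assms(2) by (auto simp: walk_between_def)
  then have "walk_between E A (E `` {y}) q"
    using q assms(3) by (auto simp: walk_between_def successively_append_iff dest: symD)
  then show thesis using that p by auto
qed

lemma walk_between_restrict:
  assumes "walk_between E A B p" "set p \<subseteq> W"
  shows "walk_between (E \<inter> W \<times> W) (A \<inter> W) B p"
proof -
  have "successively (\<lambda>u v. (u, v) \<in> E \<inter> W \<times> W) p"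
    using assms unfolding walk_between_def by (auto elim!: successively_mono)
  then show ?thesis using assms unfolding walk_between_def by (auto dest: hd_in_set)
qed

lemma walk_between_restrictD:
  assumes "walk_between (E \<inter> W \<times> W) (A \<inter> W) B p"
  shows "walk_between E A B p" "set p \<subseteq> W"
proof -
  show "walk_between E A B p" using assms walk_between_mono by blast
  have "set p \<subseteq> W" if "successively (\<lambda>u v. (u, v) \<in> E \<inter> W \<times> W) p" "p \<noteq> []" "hd p \<in> W" for p
    using that by (induction p rule: induct_list012) auto
  then show "set p \<subseteq> W" using assms unfolding walk_between_def by blast
qed

text \<open>Menger's theorem in the form that connectivity delivers: no fewer than \<open>k\<close>
  deletions block all walks inside \<open>W\<close>. The starting set is intersected with
  \<open>W\<close> as well, since a walk of one vertex uses no arc that could confine it.\<close>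

lemma menger_on:
  assumes "finite W"
    and "\<And>F. finite F \<Longrightarrow> card F < k \<Longrightarrow> \<exists>p. walk_between E A B p \<and> set p \<subseteq> W - F"
  shows "\<exists>P. finite P \<and> card P = k \<and> (\<forall>p\<in>P. walk_between E A B p \<and> set p \<subseteq> W) \<and>
             pairwise (\<lambda>p q. set p \<inter> set q = {}) P"
proof -
  have "\<exists>P. finite P \<and> card P = k \<and> (\<forall>p\<in>P. walk_between (E \<inter> W \<times> W) (A \<inter> W) B p) \<and>
             pairwise (\<lambda>p q. set p \<inter> set q = {}) P"
  proof (rule menger)
    show "k \<le> card T" if T: "finite T" "\<And>p. walk_between (E \<inter> W \<times> W) (A \<inter> W) B p \<Longrightarrow> set p \<inter> T \<noteq> {}" for T
    proof (rule ccontr)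
      assume "\<not> k \<le> card T"
      then obtain p where "walk_between E A B p" "set p \<subseteq> W - T" using assms(2) T(1) by force
      then show False using T(2)[of p] walk_between_restrict[of E A B p W] by blast
    qed
  qed (use assms(1) in auto)
  then show ?thesis using walk_between_restrictD by metis
qed

text \<open>Menger's theorem between the neighbours of \<open>z\<close> and \<open>T - {z}\<close>,
  applied inside \<open>C - {z}\<close>, gives one walk for each target; \<open>z\<close> is then
  added to all of them. If \<open>z\<close> is itself a target, its share is
  \<open>{z}\<close>.\<close>

lemma fan:
  assumes "sym E" "finite C" "k_connected k E C" "z \<in> C" "T \<subseteq> C" "card T \<le> k"
  obtains Q where "\<And>t. t \<in> T \<Longrightarrow> conn_on E (Q t) \<and> z \<in> Q t \<and> t \<in> Q t \<and> Q t \<subseteq> C"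
    and "\<And>s t. s \<in> T \<Longrightarrow> t \<in> T \<Longrightarrow> s \<noteq> t \<Longrightarrow> Q s \<inter> Q t = {z}"
proof -
  have finT: "finite T" using assms(2,5) finite_subset by blast
  have "\<exists>P. finite P \<and> card P = card (T - {z}) \<and>
      (\<forall>p\<in>P. walk_between E (E `` {z}) (T - {z}) p \<and> set p \<subseteq> C - {z}) \<and>
      pairwise (\<lambda>p q. set p \<inter> set q = {}) P"
  proof (rule menger_on)
    fix F :: "'a set" assume F: "finite F" "card F < card (T - {z})"
    then obtain t where t: "t \<in> T - {z}" "t \<notin> F"
      by (metis card_mono leD subsetI)
    have "card (F - {z}) \<le> card F" "card (T - {z}) \<le> card T" using F(1) finT by (auto intro: card_mono)
    \<comment> \<open>The centre \<open>z\<close> has to survive even if it belongs to the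
      separating set; the walk is cut behind \<open>z\<close> afterwards.\<close>
    then have conn: "conn_on E (C - (F - {z}))"
      using F assms(6) by (intro k_connectedD[OF assms(3)]) auto
    have "z \<in> C - (F - {z})" "t \<in> C - (F - {z})" using t assms(4,5) by auto
    then obtain p where p: "walk_between E {z} {t} p" "set p \<subseteq> C - (F - {z})"
      using rtrancl_imp_walk[OF conn_onD[OF conn]] by blast
    then obtain q where q: "walk_between E (E `` {z}) {t} q" "set q \<subseteq> set p - {z}"
      using walk_between_leave[OF p(1)] t by blast
    from q(1) have "walk_between E (E `` {z}) (T - {z}) q"
      by (rule walk_between_mono) (use t in auto)
    moreover have "set q \<subseteq> C - {z} - F" using p(2) q(2) by blast
    ultimately show "\<exists>p. walk_between E (E `` {z}) (T - {z}) p \<and> set p \<subseteq> C - {z} - F"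
      by blast
  qed (use assms in auto)
  then obtain P where P: "finite P" "card P = card (T - {z})"
    and Pw: "\<And>p. p \<in> P \<Longrightarrow> walk_between E (E `` {z}) (T - {z}) p \<and> set p \<subseteq> C - {z}"
    and Pd: "pairwise (\<lambda>p q. set p \<inter> set q = {}) P"
    by (elim exE conjE) auto
  have "inj_on last P"
    using Pw Pd unfolding inj_on_def pairwise_def walk_between_def
    by (metis IntI empty_iff last_in_set)
  moreover have "last ` P \<subseteq> T - {z}" using Pw by (auto simp: walk_between_def)
  ultimately have b: "bij_betw last P (T - {z})"
    using P finT by (intro bij_betw_inj_card) auto
  define f where "f = inv_into P last"
  have f: "f s \<in> P" "last (f s) = s" if "s \<in> T - {z}" for s
    using that b unfolding f_def bij_betw_def by (metis inv_into_into, metis f_inv_into_f)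
  define Q where "Q t = insert z (if t = z then {} else set (f t))" for t
  show thesis
  proof (rule that[of Q])
    fix t assume t: "t \<in> T"
    show "conn_on E (Q t) \<and> z \<in> Q t \<and> t \<in> Q t \<and> Q t \<subseteq> C"
    proof (cases "t = z")
      case True
      then show ?thesis using assms(4) by (simp add: Q_def conn_on_singleton)
    next
      case False
      then have ft: "f t \<in> P" "last (f t) = t" using f t by auto
      note w = Pw[OF ft(1)]
      have w': "f t \<noteq> []" "successively (\<lambda>u v. (u, v) \<in> E) (f t)" "(z, hd (f t)) \<in> E"
        using w by (auto simp: walk_between_def)
      have "conn_on E ({z} \<union> set (f t))"
        by (rule conn_on_edge_Un[OF assms(1) conn_on_singleton conn_on_walk[OF assms(1) w'(2)]])
          (use w' in auto)
      moreover have "t \<in> set (f t)" using ft w'(1) last_in_set by metis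
      moreover have "set (f t) \<subseteq> C" using w by blast
      ultimately show ?thesis using False assms(4) by (simp add: Q_def)
    qed
  next
    fix s t assume st: "s \<in> T" "t \<in> T" "s \<noteq> t"
    show "Q s \<inter> Q t = {z}"
    proof (cases "s = z \<or> t = z")
      case True
      then show ?thesis using st by (auto simp: Q_def)
    next
      case False
      then have fs: "f s \<in> P" "last (f s) = s" and ft: "f t \<in> P" "last (f t) = t"
        using f st by auto
      then have "f s \<noteq> f t" using st(3) by metis
      then have "set (f s) \<inter> set (f t) = {}" by (rule pairwiseD[OF Pd fs(1) ft(1)])
      then show ?thesis using False by (auto simp: Q_def)
    qed
  qed
qed

text \<open>
  The walks consist of the inner vertices only, so the empty list stands for the arc \<open>(x, y)\<close>.
\<close>
lemma disjoint_walks: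
  assumes "sym E" "finite A" "k_connected k E A" "x \<in> A" "y \<in> A" "x \<noteq> y" "k \<ge> 1" "(x, x) \<notin> E"
    and "(x, y) \<in> E \<Longrightarrow> k \<le> card (E `` {x} \<inter> A)"
  obtains P where "finite P" "card P = k"
    and "\<And>p. p \<in> P \<Longrightarrow> set p \<subseteq> A - {x, y}"
    and "\<And>p. p \<in> P \<Longrightarrow> p = [] \<and> (x, y) \<in> E \<or> walk_between E (E `` {x}) (E `` {y}) p"
    and "pairwise (\<lambda>p q. set p \<inter> set q = {}) P"
proof (cases "(x, y) \<in> E")
  case False
  have "\<exists>P. finite P \<and> card P = k \<and>
      (\<forall>p\<in>P. walk_between E (E `` {x}) (E `` {y}) p \<and> set p \<subseteq> A - {x, y}) \<and>
      pairwise (\<lambda>p q. set p \<inter> set q = {}) P"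
  proof (rule menger_on)
    fix F :: "'a set" assume F: "finite F" "card F < k"
    have "card (F - {x, y}) \<le> card F" using F(1) by (auto intro: card_mono)
    then have conn: "conn_on E (A - (F - {x, y}))"
      using F by (intro k_connectedD[OF assms(3)]) auto
    have "x \<in> A - (F - {x, y})" "y \<in> A - (F - {x, y})" using assms(4,5) by auto
    then obtain p where p: "walk_between E {x} {y} p" "set p \<subseteq> A - (F - {x, y})"
      using rtrancl_imp_walk[OF conn_onD[OF conn]] by blast
    obtain q where q: "walk_between E (E `` {x}) {y} q" "set q \<subseteq> set p - {x}"
      using walk_between_leave[OF p(1)] assms(6) by blast
    obtain r where "walk_between E (E `` {x}) (E `` {y}) r" "set r \<subseteq> set q - {y}"
      using walk_between_arrive[OF q(1) _ assms(1)] False by blast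
    then show "\<exists>p. walk_between E (E `` {x}) (E `` {y}) p \<and> set p \<subseteq> A - {x, y} - F"
      using p q by blast
  qed (use assms in auto)
  then obtain P where "finite P" "card P = k"
    "\<forall>p\<in>P. walk_between E (E `` {x}) (E `` {y}) p \<and> set p \<subseteq> A - {x, y}"
    "pairwise (\<lambda>p q. set p \<inter> set q = {}) P"
    by (elim exE conjE)
  then show ?thesis using that[of P] by blast
next
  case True
  \<comment> \<open>The arc \<open>(x, y)\<close> provides one of the \<open>k\<close> walks, so
    \<open>k - 1\<close> are left to find.\<close>
  have "\<exists>P. finite P \<and> card P = k - 1 \<and>
      (\<forall>p\<in>P. walk_between E (E `` {x}) (E `` {y}) p \<and> set p \<subseteq> A - {x, y}) \<and>
      pairwise (\<lambda>p q. set p \<inter> set q = {}) P"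
  proof (rule menger_on)
    fix F :: "'a set" assume F: "finite F" "card F < k - 1"
    \<comment> \<open>The degree bound leaves a neighbour \<open>w\<close> of \<open>x\<close> other
      than \<open>y\<close> and outside \<open>F\<close>. Starting at \<open>w\<close>, the walk can
      be sought after deleting \<open>x\<close> too, which still makes fewer than \<open>k\<close>
      deletions.\<close>
    have "card (insert y F) < card (E `` {x} \<inter> A)"
      using F assms(9)[OF True] by (auto simp: card_insert_if)
    then obtain w where w: "w \<in> E `` {x} \<inter> A" "w \<notin> insert y F"
      using F(1) by (metis card_mono finite_insert leD subsetI)
    have "card (insert x (F - {y})) \<le> Suc (card (F - {y}))" using F(1) by (simp add: card_insert_if)
    moreover have "card (F - {y}) \<le> card F" using F(1) by (auto intro: card_mono)
    ultimately have conn: "conn_on E (A - insert x (F - {y}))"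
      using F by (intro k_connectedD[OF assms(3)]) auto
    have "w \<in> A - insert x (F - {y})" "y \<in> A - insert x (F - {y})" using assms(5,6,8) w by auto
    then obtain p where p: "walk_between E {w} {y} p" "set p \<subseteq> A - insert x (F - {y})"
      using rtrancl_imp_walk[OF conn_onD[OF conn]] by blast
    obtain r where "walk_between E {w} (E `` {y}) r" "set r \<subseteq> set p - {y}"
      using walk_between_arrive[OF p(1) _ assms(1)] w by blast
    moreover from this have "walk_between E (E `` {x}) (E `` {y}) r"
      using walk_between_mono[of E "{w}" "E `` {y}" r E "E `` {x}"] w by blast
    ultimately show "\<exists>p. walk_between E (E `` {x}) (E `` {y}) p \<and> set p \<subseteq> A - {x, y} - F"
      using p by blast
  qed (use assms in auto)
  then obtain P where P: "finite P" "card P = k - 1"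
    "\<forall>p\<in>P. walk_between E (E `` {x}) (E `` {y}) p \<and> set p \<subseteq> A - {x, y}"
    "pairwise (\<lambda>p q. set p \<inter> set q = {}) P"
    by (elim exE conjE)
  have "[] \<notin> P" using P(3) by (auto simp: walk_between_def)
  then have "card (insert [] P) = k" using P(1,2) assms(7) by simp
  moreover have "pairwise (\<lambda>p q. set p \<inter> set q = {}) (insert [] P)"
    using P(4) by (auto simp: pairwise_insert)
  ultimately show ?thesis
    by (intro that[of "insert [] P"]) (use P True in auto)
qed

section \<open>Linking three vertices\<close>

text \<open>Connected symmetric arc sets in place of trees. They are recorded apart from the vertex
  sets because any two vertex sets share \<open>S\<close>: the induced arc sets would overlap as
  soon as two vertices of \<open>S\<close> are adjacent.\<close>

definition linked :: "('a \<times> 'a) set \<Rightarrow> 'a set \<Rightarrow> 'a set \<Rightarrow> nat \<Rightarrow> bool" where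
  "linked E V S r \<longleftrightarrow> (\<exists>W D.
     (\<forall>i<r. S \<subseteq> W i \<and> W i \<subseteq> V \<and> D i \<subseteq> E \<inter> W i \<times> W i \<and> sym (D i) \<and> conn_on (D i) (W i)) \<and>
     (\<forall>i<r. \<forall>j<r. i \<noteq> j \<longrightarrow> W i \<inter> W j = S \<and> D i \<inter> D j = {}))"

lemma linked_familyI:
  assumes "finite P" "card P = r"
    and "\<And>p. p \<in> P \<Longrightarrow> S \<subseteq> W p \<and> W p \<subseteq> V \<and> D p \<subseteq> E \<inter> W p \<times> W p \<and> sym (D p) \<and> conn_on (D p) (W p)"
    and "\<And>p q. p \<in> P \<Longrightarrow> q \<in> P \<Longrightarrow> p \<noteq> q \<Longrightarrow> W p \<inter> W q = S \<and> D p \<inter> D q = {}"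
  shows "linked E V S r"
proof -
  obtain h where "bij_betw h {0..<r} P" using ex_bij_betw_nat_finite assms(1,2) by blast
  then have h: "h i \<in> P" "\<And>j. j < r \<Longrightarrow> i \<noteq> j \<Longrightarrow> h i \<noteq> h j" if "i < r" for i
    using that by (auto simp: bij_betw_def inj_on_def)
  show ?thesis
    unfolding linked_def
  proof (rule exI[of _ "\<lambda>i. W (h i)"], rule exI[of _ "\<lambda>i. D (h i)"], rule conjI; intro allI impI)
    fix i assume "i < r"
    then show "S \<subseteq> W (h i) \<and> W (h i) \<subseteq> V \<and> D (h i) \<subseteq> E \<inter> W (h i) \<times> W (h i) \<and>
        sym (D (h i)) \<and> conn_on (D (h i)) (W (h i))"
      by (intro assms(3) h(1))
  next
    fix i j assume "i < r" "j < r" "i \<noteq> j"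
    then show "W (h i) \<inter> W (h j) = S \<and> D (h i) \<inter> D (h j) = {}"
      by (intro assms(4) h)
  qed
qed

lemma linkedE:
  assumes "linked E V S r"
  obtains W D where
    "\<And>i. i < r \<Longrightarrow> S \<subseteq> W i \<and> W i \<subseteq> V \<and> D i \<subseteq> E \<inter> W i \<times> W i \<and> sym (D i) \<and> conn_on (D i) (W i)"
    "\<And>i j. i < r \<Longrightarrow> j < r \<Longrightarrow> i \<noteq> j \<Longrightarrow> W i \<inter> W j = S \<and> D i \<inter> D j = {}"
proof -
  from assms[unfolded linked_def] obtain W D where
    "\<forall>i<r. S \<subseteq> W i \<and> W i \<subseteq> V \<and> D i \<subseteq> E \<inter> W i \<times> W i \<and> sym (D i) \<and> conn_on (D i) (W i)"
    "\<forall>i<r. \<forall>j<r. i \<noteq> j \<longrightarrow> W i \<inter> W j = S \<and> D i \<inter> D j = {}"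
    by (elim exE conjE)
  then show thesis by (intro that[of W D]) simp_all
qed

lemma linked_mono:
  assumes "linked E V S r" "E \<inter> V \<times> V \<subseteq> E'"
  shows "linked E' V S r"
proof -
  obtain W D where
    WD: "\<And>i. i < r \<Longrightarrow> S \<subseteq> W i \<and> W i \<subseteq> V \<and> D i \<subseteq> E \<inter> W i \<times> W i \<and> sym (D i) \<and> conn_on (D i) (W i)"
    and dis: "\<And>i j. i < r \<Longrightarrow> j < r \<Longrightarrow> i \<noteq> j \<Longrightarrow> W i \<inter> W j = S \<and> D i \<inter> D j = {}"
    using assms(1) by (rule linkedE) blast
  show ?thesis
    unfolding linked_def
  proof (rule exI[of _ W], rule exI[of _ D], intro conjI allI impI)
    fix i assume i: "i < r"
    show "D i \<subseteq> E' \<inter> W i \<times> W i" using WD[OF i] assms(2) by blast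
    show "S \<subseteq> W i" "W i \<subseteq> V" "sym (D i)" "conn_on (D i) (W i)" using WD[OF i] by simp_all
  next
    fix i j assume "i < r" "j < r" "i \<noteq> j"
    then show "W i \<inter> W j = S" "D i \<inter> D j = {}" using dis by simp_all
  qed
qed

text \<open>Arcs inside \<open>S\<close> are withheld from the new member. Each of its other arcs
  has an end outside \<open>V\<close> and so belongs to no earlier arc set.\<close>

lemma linked_Suc:
  assumes "linked E V S r" "sym E" "S \<subseteq> V'" "V' \<subseteq> U" "V \<subseteq> U" "V \<inter> V' = S" "conn_on (E - S \<times> S) V'"
  shows "linked E U S (Suc r)"
proof -
  obtain W D where
    WD: "\<And>i. i < r \<Longrightarrow> S \<subseteq> W i \<and> W i \<subseteq> V \<and> D i \<subseteq> E \<inter> W i \<times> W i \<and> sym (D i) \<and> conn_on (D i) (W i)"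
    and dis: "\<And>i j. i < r \<Longrightarrow> j < r \<Longrightarrow> i \<noteq> j \<Longrightarrow> W i \<inter> W j = S \<and> D i \<inter> D j = {}"
    using assms(1) by (rule linkedE) blast
  define W' where "W' = W(r := V')"
  define D' where "D' = D(r := (E - S \<times> S) \<inter> V' \<times> V')"
  have symD: "sym (D' r)" using assms(2) by (auto simp: D'_def sym_def)
  have conn: "conn_on (D' r) (W' r)"
    using assms(7) by (auto simp: D'_def W'_def intro: conn_on_mono)
  have new: "W i \<inter> V' = S \<and> D i \<inter> D' r = {}" if "i < r" for i
    using WD[OF that] assms(3,6) by (auto simp: D'_def)
  show ?thesis
    unfolding linked_def
  proof (rule exI[of _ W'], rule exI[of _ D'], intro conjI allI impI)
    fix i assume "i < Suc r"
    then consider "i < r" | "i = r" by linarith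
    then show "S \<subseteq> W' i" "W' i \<subseteq> U" "D' i \<subseteq> E \<inter> W' i \<times> W' i" "sym (D' i)" "conn_on (D' i) (W' i)"
      using WD[of i] assms(3-5) symD conn by (cases; auto simp: W'_def D'_def)+
  next
    fix i j assume ij: "i < Suc r" "j < Suc r" "i \<noteq> j"
    then consider "i < r" "j < r" | "i = r" "j < r" | "i < r" "j = r" by linarith
    then have "W' i \<inter> W' j = S \<and> D' i \<inter> D' j = {}"
    proof cases
      case 1
      then show ?thesis using dis[of i j] ij by (simp add: W'_def D'_def)
    next
      case 2
      then show ?thesis using new[of j] by (auto simp: W'_def D'_def)
    next
      case 3
      then show ?thesis using new[of i] by (auto simp: W'_def D'_def)
    qed
    then show "W' i \<inter> W' j = S" "D' i \<inter> D' j = {}" by simp_all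
  qed
qed

lemma linked_image:
  assumes "linked E V S r" "inj_on f V" "S \<subseteq> V"
    and "\<And>u v. u \<in> V \<Longrightarrow> v \<in> V \<Longrightarrow> (u, v) \<in> E \<Longrightarrow> (f u, f v) \<in> E'"
  shows "linked E' (f ` V) (f ` S) r"
proof -
  obtain W D where
    WD: "\<And>i. i < r \<Longrightarrow> S \<subseteq> W i \<and> W i \<subseteq> V \<and> D i \<subseteq> E \<inter> W i \<times> W i \<and> sym (D i) \<and> conn_on (D i) (W i)"
    and dis: "\<And>i j. i < r \<Longrightarrow> j < r \<Longrightarrow> i \<noteq> j \<Longrightarrow> W i \<inter> W j = S \<and> D i \<inter> D j = {}"
    using assms(1) by (rule linkedE) blast
  let ?D = "\<lambda>i. map_prod f f ` D i"
  have inj: "inj_on (map_prod f f) (V \<times> V)" using assms(2) by (rule map_prod_inj_on) fact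
  show ?thesis
    unfolding linked_def
  proof (rule exI[of _ "\<lambda>i. f ` W i"], rule exI[of _ ?D], intro conjI allI impI)
    fix i assume i: "i < r"
    note w = WD[OF i]
    show "f ` S \<subseteq> f ` W i" "f ` W i \<subseteq> f ` V" using w by auto
    have "(f u, f v) \<in> E' \<inter> f ` W i \<times> f ` W i" if "(u, v) \<in> D i" for u v
      using that w assms(4)[of u v] by blast
    then show "?D i \<subseteq> E' \<inter> f ` W i \<times> f ` W i" by auto
    show "sym (?D i)" using w by (auto simp: sym_def)
    show "conn_on (?D i) (f ` W i)"
      by (rule conn_on_image[where E = "D i"]) (use w in \<open>auto intro: image_eqI\<close>)
  next
    fix i j assume ij: "i < r" "j < r" "i \<noteq> j"
    show "f ` W i \<inter> f ` W j = f ` S"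
      using inj_on_image_Int[OF assms(2), of "W i" "W j"] WD[OF ij(1)] WD[OF ij(2)] dis[OF ij] by simp
    have "D i \<subseteq> V \<times> V" "D j \<subseteq> V \<times> V" using WD[OF ij(1)] WD[OF ij(2)] by blast+
    then show "?D i \<inter> ?D j = {}"
      using inj_on_image_Int[OF inj, of "D i" "D j"] dis[OF ij] by simp
  qed
qed

text \<open>
  Each of \<open>k\<close> disjoint \<open>x\<close>-\<open>y\<close> walks in \<open>A\<close> is left through an arc \<open>(w, g w)\<close> into \<open>C\<close>, and a fan in \<open>C\<close>
  joins the \<open>k\<close> entry points to \<open>z\<close>.  A walk none of whose inner vertices has its \<open>g\<close>-neighbour
  in \<open>C\<close> is left through \<open>x\<close> or \<open>y\<close> instead; the hypotheses allow only one such walk, and only it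
  may use arcs between the three given vertices.
\<close>
theorem linked_core:
  fixes E :: "('a \<times> 'a) set" and g :: "'a \<Rightarrow> 'a"
  assumes E: "sym E" "\<And>v. v \<in> A \<union> C \<Longrightarrow> (v, v) \<notin> E"
    and AC: "finite A" "finite C" "A \<inter> C = {}" "k_connected k E A" "k_connected k E C" "k \<ge> 1"
    and xyz: "x \<in> A" "y \<in> A" "x \<noteq> y" "z \<in> C"
    and g: "\<And>u. u \<in> A \<Longrightarrow> (u, g u) \<in> E \<and> g u \<in> A \<union> C \<and> g (g u) = u"
    and crossing: "\<And>u v. u \<in> A \<Longrightarrow> v \<in> A \<Longrightarrow> (u, v) \<in> E \<Longrightarrow> g u \<in> A \<Longrightarrow> g v \<in> A \<Longrightarrow> v = g u"
    and unique: "\<And>u v. u \<in> A \<Longrightarrow> v \<in> A \<Longrightarrow> (x, u) \<in> E \<Longrightarrow> (x, v) \<in> E \<Longrightarrow> g u \<in> A \<Longrightarrow> g v \<in> A \<Longrightarrow> u = v"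
    and adjacent: "(x, y) \<in> E \<Longrightarrow> g ` A \<subseteq> C \<and> k \<le> card (E `` {x} \<inter> A)"
  shows "linked E (A \<union> C) {x, y, z} k"
proof -
  let ?S = "{x, y, z}"
  have g_inj: "inj_on g A" using g by (metis inj_onI)
  obtain P where P: "finite P" "card P = k"
    and PA: "\<And>p. p \<in> P \<Longrightarrow> set p \<subseteq> A - {x, y}"
    and Pw: "\<And>p. p \<in> P \<Longrightarrow> p = [] \<and> (x, y) \<in> E \<or> walk_between E (E `` {x}) (E `` {y}) p"
    and Pd: "pairwise (\<lambda>p q. set p \<inter> set q = {}) P"
  proof (rule disjoint_walks[OF E(1) AC(1,4) xyz(1,2,3) AC(6)])
    show "(x, x) \<notin> E" using E(2) xyz(1) by blast
    show "k \<le> card (E `` {x} \<inter> A)" if "(x, y) \<in> E" using adjacent that by blast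
  qed blast
  \<comment> \<open>A bad walk has no inner vertex with an exit into \<open>C\<close>; the empty
    walk is bad vacuously.\<close>
  define bad where "bad p \<longleftrightarrow> (\<forall>u\<in>set p. g u \<notin> C)" for p
  have bad_nonadj: "(x, y) \<notin> E" if "p \<in> P" "bad p" "p \<noteq> []" for p
  proof
    assume "(x, y) \<in> E"
    then have "g (hd p) \<in> C" using adjacent PA[OF that(1)] that(3) by (auto dest: hd_in_set)
    then show False using that by (auto simp: bad_def)
  qed
  have bad_hd: "hd p \<in> A" "(x, hd p) \<in> E" "g (hd p) \<in> A" if "p \<in> P" "bad p" "p \<noteq> []" for p
  proof -
    have "hd p \<in> set p" using that by simp
    then show "hd p \<in> A" "g (hd p) \<in> A" using PA[OF that(1)] that(2) g by (auto simp: bad_def)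
    show "(x, hd p) \<in> E" using Pw[OF that(1)] that(3) by (auto simp: walk_between_def)
  qed
  \<comment> \<open>If \<open>(x, y)\<close> is an arc, only the empty walk is bad. Otherwise
    \<open>unique\<close> makes the first vertices of bad walks coincide, and distinct walks are
    disjoint.\<close>
  have bad_unique: "p = q" if "p \<in> P" "q \<in> P" "bad p" "bad q" for p q
  proof (cases "p = [] \<or> q = []")
    case True
    then have "(x, y) \<in> E" using Pw[OF that(1)] Pw[OF that(2)] by (auto simp: walk_between_def)
    then show ?thesis using bad_nonadj[of p] bad_nonadj[of q] that by argo
  next
    case False
    then have "hd p = hd q" using bad_hd[of p] bad_hd[of q] unique that by blast
    then have "set p \<inter> set q \<noteq> {}" using False by (metis IntI empty_iff hd_in_set)
    then show ?thesis using Pd that unfolding pairwise_def by blast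
  qed
  \<comment> \<open>If \<open>g x\<close> and \<open>g y\<close> both lay in \<open>A\<close>, then
    \<open>unique\<close> would make the bad walk start with \<open>g x\<close>. By
    \<open>crossing\<close> the vertex after it would be \<open>x\<close>, or, if there is none,
    \<open>g x\<close> would equal \<open>g y\<close>; both are impossible.\<close>
  have bad_exit: "g x \<in> C \<or> g y \<in> C" if p: "p \<in> P" "bad p" for p
  proof (rule ccontr)
    assume none: "\<not> ?thesis"
    then have gxy: "g x \<in> A" "g y \<in> A" using g xyz by blast+
    have nonadj: "(x, y) \<notin> E"
    proof
      assume "(x, y) \<in> E"
      then have "g ` A \<subseteq> C" using adjacent by simp
      then show False using none xyz(1) by blast
    qed
    have w: "walk_between E (E `` {x}) (E `` {y}) p" using Pw[OF p(1)] nonadj by simp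
    then have ne: "p \<noteq> []" by (simp add: walk_between_def)
    have u: "hd p = g x"
      using unique[of "hd p" "g x"] bad_hd[OF p ne] g[OF xyz(1)] gxy xyz(1) by simp
    show False
    proof (cases "tl p")
      case Nil
      then have "(y, hd p) \<in> E" using w ne by (cases p) (auto simp: walk_between_def)
      then have "hd p = g y" using crossing[of y "hd p"] bad_hd[OF p ne] gxy xyz by blast
      then show False using u g_inj xyz by (auto dest: inj_onD)
    next
      case (Cons v q)
      then have pq: "p = hd p # v # q" using ne by (cases p) auto
      have "successively (\<lambda>u v. (u, v) \<in> E) p" using w by (simp add: walk_between_def)
      then have "(hd p, v) \<in> E" by (subst (asm) pq) simp
      moreover have "v \<in> set p" by (subst pq) simp
      then have "v \<in> A" "g v \<in> A" "v \<noteq> x" using PA[OF p(1)] p(2) g by (auto simp: bad_def)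
      ultimately have "v = g (hd p)" using crossing bad_hd[OF p ne] by blast
      then show False using u g[OF xyz(1)] \<open>v \<noteq> x\<close> by simp
    qed
  qed
  have "\<exists>w. w \<in> set p \<union> {x, y} \<and> g w \<in> C \<and> (bad p \<or> w \<in> set p)" if "p \<in> P" for p
  proof (cases "bad p")
    case True
    then show ?thesis using bad_exit[OF that] by blast
  next
    case False
    then show ?thesis unfolding bad_def by blast
  qed
  then obtain w where w: "\<And>p. p \<in> P \<Longrightarrow> w p \<in> set p \<union> {x, y} \<and> g (w p) \<in> C \<and> (bad p \<or> w p \<in> set p)"
    by metis
  have wA: "w p \<in> A" if "p \<in> P" for p using w[OF that] PA[OF that] xyz by blast
  \<comment> \<open>Only a bad walk may exit at \<open>x\<close> or \<open>y\<close>, and there is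
    at most one; all others exit at inner vertices, which are disjoint.\<close>
  have w_inj: "inj_on w P"
  proof (rule inj_onI, rule ccontr)
    fix p q assume pq: "p \<in> P" "q \<in> P" "w p = w q" "p \<noteq> q"
    then have "set p \<inter> set q = {}" using Pd by (auto simp: pairwise_def)
    moreover have "\<not> bad p \<or> \<not> bad q" using bad_unique pq by blast
    ultimately show False using w[OF pq(1)] w[OF pq(2)] PA[OF pq(1)] PA[OF pq(2)] pq(3) by auto
  qed
  let ?t = "\<lambda>p. g (w p)"
  have t_inj: "inj_on ?t P"
  proof (rule inj_onI)
    fix p q assume pq: "p \<in> P" "q \<in> P" "g (w p) = g (w q)"
    then have "w p = w q" using inj_onD[OF g_inj] wA by blast
    then show "p = q" using inj_onD[OF w_inj] pq by blast
  qed
  have tC: "?t ` P \<subseteq> C" using w by blast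
  have "card (?t ` P) \<le> k" using P card_image_le by metis
  then obtain Q where Q: "\<And>t. t \<in> ?t ` P \<Longrightarrow> conn_on E (Q t) \<and> z \<in> Q t \<and> t \<in> Q t \<and> Q t \<subseteq> C"
    and Qd: "\<And>s t. s \<in> ?t ` P \<Longrightarrow> t \<in> ?t ` P \<Longrightarrow> s \<noteq> t \<Longrightarrow> Q s \<inter> Q t = {z}"
    using fan[OF E(1) AC(2,5) xyz(4) tC] by blast
  define R where "R p = Q (?t p)" for p
  have R: "conn_on E (R p)" "z \<in> R p" "?t p \<in> R p" "R p \<subseteq> C" if "p \<in> P" for p
    using Q[of "?t p"] that by (auto simp: R_def)
  have Rd: "R p \<inter> R q = {z}" if "p \<in> P" "q \<in> P" "p \<noteq> q" for p q
    unfolding R_def by (rule Qd) (use that inj_onD[OF t_inj] in auto)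
  define W where "W p = (set p \<union> {x, y}) \<union> R p" for p
  \<comment> \<open>Distinct \<open>W p\<close> and \<open>W q\<close> meet exactly in
    \<open>?S\<close>, so only arcs inside \<open>?S\<close> could be shared. They are reserved for
    the bad walk, which may consist of the arc \<open>(x, y)\<close> or exit from \<open>x\<close>
    or \<open>y\<close> directly to \<open>z\<close>.\<close>
  define E' where "E' p = E - (if bad p then {} else ?S \<times> ?S)" for p
  have E'sym: "sym (E' p)" for p using E(1) by (auto simp: E'_def sym_def)
  have S_C: "?S \<inter> C = {z}" using xyz AC(3) by blast
  show ?thesis
  proof (rule linked_familyI[OF P, where W = W and D = "\<lambda>p. E' p \<inter> W p \<times> W p"])
    fix p assume p: "p \<in> P"
    have pS: "set p \<inter> ?S = {}" using PA[OF p] xyz AC(3) by blast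
    have conn1: "conn_on (E' p) (set p \<union> {x, y})"
    proof (cases "p = []")
      case True
      then have "(x, y) \<in> E' p" using Pw[OF p] by (auto simp: E'_def bad_def walk_between_def)
      then show ?thesis using True conn_on_edge[OF E'sym] by simp
    next
      case False
      then have walk: "walk_between E (E `` {x}) (E `` {y}) p" using Pw[OF p] by auto
      have ends: "hd p \<in> set p" "last p \<in> set p" using False by auto
      have "conn_on E (set p)" using walk conn_on_walk[OF E(1)] unfolding walk_between_def by blast
      then have c: "conn_on (E' p) (set p)"
        by (rule conn_on_mono) (use pS in \<open>auto simp: E'_def\<close>)
      have "(hd p, x) \<in> E' p" "(last p, y) \<in> E' p"
        using walk ends pS symD[OF E(1)] unfolding walk_between_def E'_def by auto
      then have "conn_on (E' p) ((set p \<union> {x}) \<union> {y})"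
        using ends
        by (intro conn_on_edge_Un[OF E'sym _ conn_on_singleton, of _ _ "last p"]
            conn_on_edge_Un[OF E'sym c conn_on_singleton, of "hd p"]) auto
      then show ?thesis by (simp add: Un_insert_right insert_commute)
    qed
    have conn2: "conn_on (E' p) (R p)"
    proof (rule conn_on_mono[OF R(1)[OF p]])
      have "(u, v) \<in> E' p" if "(u, v) \<in> E" "u \<in> R p" "v \<in> R p" for u v
      proof -
        have "u \<in> C" "v \<in> C" using that R(4)[OF p] by blast+
        moreover have "u \<noteq> v" using that E(2) \<open>u \<in> C\<close> by blast
        ultimately have "(u, v) \<notin> ?S \<times> ?S" using S_C by (metis IntI SigmaD1 SigmaD2 singletonD)
        then show ?thesis using that(1) by (auto simp: E'_def)
      qed
      then show "E \<inter> R p \<times> R p \<subseteq> E' p" by auto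
    qed
    have "(w p, ?t p) \<in> E' p"
      using w[OF p] g[OF wA[OF p]] pS unfolding E'_def by auto
    then have "conn_on (E' p) (W p)"
      unfolding W_def using w[OF p] R(3)[OF p] by (intro conn_on_edge_Un[OF E'sym conn1 conn2]) auto
    then have "conn_on (E' p \<inter> W p \<times> W p) (W p)" by (rule conn_on_mono) blast
    moreover have "sym (E' p \<inter> W p \<times> W p)" using E'sym[of p] by (auto simp: sym_def)
    ultimately show "?S \<subseteq> W p \<and> W p \<subseteq> A \<union> C \<and> E' p \<inter> W p \<times> W p \<subseteq> E \<inter> W p \<times> W p \<and>
        sym (E' p \<inter> W p \<times> W p) \<and> conn_on (E' p \<inter> W p \<times> W p) (W p)"
      using R(2,4)[OF p] PA[OF p] xyz by (auto simp: W_def E'_def)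
  next
    fix p q assume pq: "p \<in> P" "q \<in> P" "p \<noteq> q"
    have "set p \<inter> set q = {}" using Pd pq by (auto simp: pairwise_def)
    then have Wd: "W p \<inter> W q = ?S"
      using Rd[OF pq] R(2,4)[OF pq(1)] R(2,4)[OF pq(2)] PA[OF pq(1)] PA[OF pq(2)] AC(3) xyz
      unfolding W_def by blast
    have "\<not> bad p \<or> \<not> bad q" using bad_unique pq by blast
    then have "E' p \<inter> E' q \<subseteq> E - ?S \<times> ?S" by (auto simp: E'_def)
    then have "(E' p \<inter> W p \<times> W p) \<inter> (E' q \<inter> W q \<times> W q) = {}" using Wd by blast
    then show "W p \<inter> W q = ?S \<and> (E' p \<inter> W p \<times> W p) \<inter> (E' q \<inter> W q \<times> W q) = {}" using Wd by simp
  qed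
qed

section \<open>Parts of the burnt pancake graph\<close>

definition arrangements :: "int set \<Rightarrow> int list set" where
  "arrangements N = {x. map abs x \<in> permutations_of_set N}"

definition reversal_arcs :: "(int list \<times> int list) set" where
  "reversal_arcs = {(x, signed_prefix_reversal i x) | x i. 1 \<le> i \<and> i \<le> length x}"

definition flip :: "int list \<Rightarrow> int list" where
  "flip x = map uminus (rev x)"

definition part :: "int set \<Rightarrow> int \<Rightarrow> int list set" where
  "part N a = {x \<in> arrangements N. last x = a}"

lemma arrangements_iff:
  "x \<in> arrangements N \<longleftrightarrow> distinct (map abs x) \<and> abs ` set x = N"
  by (auto simp: arrangements_def permutations_of_set_def)

lemma length_arrangements: "x \<in> arrangements N \<Longrightarrow> length x = card N"
  using distinct_card[of "map abs x"] by (auto simp: arrangements_iff)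

lemma finite_arrangements:
  assumes "finite N"
  shows "finite (arrangements N)"
proof (rule finite_subset)
  show "arrangements N \<subseteq> {x. set x \<subseteq> N \<union> uminus ` N \<and> length x = card N}"
  proof safe
    fix x a assume x: "x \<in> arrangements N" "a \<in> set x" "a \<notin> uminus ` N"
    then have "\<bar>a\<bar> \<in> N" by (auto simp: arrangements_iff)
    then show "a \<in> N" using x(3) by (metis abs_if image_eqI minus_minus)
  qed (simp add: length_arrangements)
  show "finite {x. set x \<subseteq> N \<union> uminus ` N \<and> length x = card N}"
    using assms by (intro finite_lists_length_eq) simp
qed

lemma arrangements_nth_abs_eq:
  assumes "x \<in> arrangements N" "i < card N" "j < card N" "\<bar>x ! i\<bar> = \<bar>x ! j\<bar>"
  shows "i = j"
  using assms nth_eq_iff_index_eq[of "map abs x" i j]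
  by (simp add: arrangements_iff length_arrangements[OF assms(1)])

lemma arrangements_nth_mem:
  assumes "x \<in> arrangements N" "i < card N"
  shows "\<bar>x ! i\<bar> \<in> N"
  using assms by (auto simp: arrangements_iff length_arrangements[OF assms(1)])

lemma arrangements_hd_last:
  assumes "x \<in> arrangements N" "card N \<ge> 1"
  shows "hd x = x ! 0" "last x = x ! (card N - 1)" "x \<noteq> []"
proof -
  show "x \<noteq> []" using assms length_arrangements[OF assms(1)] by auto
  then show "hd x = x ! 0" "last x = x ! (card N - 1)"
    using length_arrangements[OF assms(1)] by (simp_all add: hd_conv_nth last_conv_nth)
qed

lemma length_reversal [simp]: "length (signed_prefix_reversal i x) = length x"
  by (simp add: signed_prefix_reversal_def)

lemma reversal_0: "signed_prefix_reversal 0 x = x"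
  by (simp add: signed_prefix_reversal_def)

lemma reversal_length: "signed_prefix_reversal (length x) x = flip x"
  by (simp add: signed_prefix_reversal_def flip_def)

lemma reversal_append:
  "i \<le> length x \<Longrightarrow> signed_prefix_reversal i (x @ s) = signed_prefix_reversal i x @ s"
  by (simp add: signed_prefix_reversal_def)

lemma reversal_arrangements:
  assumes "x \<in> arrangements N"
  shows "signed_prefix_reversal i x \<in> arrangements N"
proof -
  have "map abs (signed_prefix_reversal i x) = rev (take i (map abs x)) @ drop i (map abs x)"
    by (simp add: signed_prefix_reversal_def take_map drop_map rev_map comp_def)
  then have "mset (map abs (signed_prefix_reversal i x)) = mset (take i (map abs x) @ drop i (map abs x))"
    by (simp only: mset_append mset_rev)
  then have m: "mset (map abs (signed_prefix_reversal i x)) = mset (map abs x)"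
    by (simp only: append_take_drop_id)
  then have "distinct (map abs (signed_prefix_reversal i x))"
    using assms mset_eq_imp_distinct_iff unfolding arrangements_iff by blast
  moreover have "abs ` set (signed_prefix_reversal i x) = N"
    using mset_eq_setD[OF m] assms unfolding arrangements_iff by simp
  ultimately show ?thesis unfolding arrangements_iff by simp
qed

lemma hd_reversal:
  assumes "1 \<le> i" "i \<le> length x"
  shows "hd (signed_prefix_reversal i x) = - (x ! (i - 1))"
  using assms by (cases "x = []") (auto simp: signed_prefix_reversal_def hd_append hd_map hd_rev last_conv_nth)

lemma last_reversal:
  assumes "i < length x"
  shows "last (signed_prefix_reversal i x) = last x"
  using assms by (simp add: signed_prefix_reversal_def)

lemma flip_flip [simp]: "flip (flip x) = x"
  by (simp add: flip_def rev_map comp_def)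

lemma inj_flip: "inj flip"
  by (metis flip_flip injI)

lemma last_flip: "x \<noteq> [] \<Longrightarrow> last (flip x) = - hd x"
  by (simp add: flip_def last_map last_rev)

lemma flip_arrangements: "x \<in> arrangements N \<Longrightarrow> flip x \<in> arrangements N"
  using reversal_arrangements[of x N "length x"] by (simp add: reversal_length)

lemma sym_reversal_arcs: "sym reversal_arcs"
proof (rule symI)
  fix x y assume "(x, y) \<in> reversal_arcs"
  then obtain i where i: "1 \<le> i" "i \<le> length x" "y = signed_prefix_reversal i x"
    by (auto simp: reversal_arcs_def)
  then have "x = signed_prefix_reversal i y" by (simp add: signed_prefix_reversal_involution)
  then show "(y, x) \<in> reversal_arcs" using i unfolding reversal_arcs_def by auto
qed

lemma reversal_arcsI: "1 \<le> i \<Longrightarrow> i \<le> length x \<Longrightarrow> (x, signed_prefix_reversal i x) \<in> reversal_arcs"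
  by (auto simp: reversal_arcs_def)

lemma flip_arc: "x \<noteq> [] \<Longrightarrow> (x, flip x) \<in> reversal_arcs"
  using reversal_arcsI[of "length x" x] unfolding reversal_length by (simp add: Suc_le_eq)

text \<open>For \<open>1 \<le> i\<close> the new first symbol is the negative of the
  \<open>i\<close>-th one and thus reveals \<open>i\<close>. Index \<open>0\<close> stands for
  \<open>x\<close> itself: a reversal equal to \<open>x\<close> would make its first symbol its own
  negative. Including it yields freedom from loops and one extra vertex in the counts.\<close>

lemma inj_on_reversal:
  assumes "x \<in> arrangements N" "0 \<notin> N"
  shows "inj_on (\<lambda>i. signed_prefix_reversal i x) {0..card N}"
proof (rule inj_onI)
  note len = length_arrangements[OF assms(1)]
  have nonzero: "x ! i \<noteq> 0" if "i < card N" for i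
    using arrangements_nth_mem[OF assms(1) that] assms(2) by auto
  have neq: "signed_prefix_reversal i x \<noteq> x" if i: "i \<in> {1..card N}" for i
  proof
    assume "signed_prefix_reversal i x = x"
    then have h: "- (x ! (i - 1)) = x ! 0"
      using hd_reversal[of i x] i len arrangements_hd_last(1)[OF assms(1)] by auto
    then have "i - 1 = 0"
      using i by (intro arrangements_nth_abs_eq[OF assms(1)]) (auto simp flip: h)
    then show False using h nonzero[of 0] i by auto
  qed
  fix i j assume ij: "i \<in> {0..card N}" "j \<in> {0..card N}" "signed_prefix_reversal i x = signed_prefix_reversal j x"
  consider "i = 0" "j = 0" | "i = 0" "j \<in> {1..card N}" | "j = 0" "i \<in> {1..card N}"
    | "i \<in> {1..card N}" "j \<in> {1..card N}" using ij by fastforce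
  then show "i = j"
  proof cases
    case 4
    then have "x ! (i - 1) = x ! (j - 1)"
      using hd_reversal[of i x] hd_reversal[of j x] ij(3) len by auto
    then have "i - 1 = j - 1" using 4 by (intro arrangements_nth_abs_eq[OF assms(1)]) auto
    then show ?thesis using 4 by auto
  qed (use ij neq in \<open>metis reversal_0\<close>)+
qed

lemma no_loops:
  assumes "x \<in> arrangements N" "0 \<notin> N"
  shows "(x, x) \<notin> reversal_arcs"
proof
  assume "(x, x) \<in> reversal_arcs"
  then obtain i where i: "1 \<le> i" "i \<le> card N" "x = signed_prefix_reversal i x"
    using length_arrangements[OF assms(1)] by (auto simp: reversal_arcs_def)
  then show False using inj_onD[OF inj_on_reversal[OF assms], of i 0] by (auto simp: reversal_0)
qed

text \<open>One vertex together with its reversals. The true number grows like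
  \<open>2^k * k!\<close> for \<open>k = card N\<close>, but this linear bound covers all later
  counts.\<close>

lemma card_arrangements_ge:
  assumes "finite N" "\<And>a. a \<in> N \<Longrightarrow> 0 < a"
  shows "card (arrangements N) \<ge> card N + 1"
proof -
  define x where "x = sorted_list_of_set N"
  have abs: "map abs x = x" using assms by (intro map_idI abs_of_pos) (simp add: x_def)
  then have x: "x \<in> arrangements N"
    unfolding arrangements_def permutations_of_set_def mem_Collect_eq abs
    using assms(1) by (simp add: x_def)
  have "card ((\<lambda>i. signed_prefix_reversal i x) ` {0..card N}) = card N + 1"
    using inj_on_reversal[OF x] assms(2) by (subst card_image) auto
  moreover have "(\<lambda>i. signed_prefix_reversal i x) ` {0..card N} \<subseteq> arrangements N"
    using reversal_arrangements[OF x] by blast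
  ultimately show ?thesis using card_mono[OF finite_arrangements[OF assms(1)]] by metis
qed

section \<open>Parts and the edges between them\<close>

lemma part_subset: "part N a \<subseteq> arrangements N" by (auto simp: part_def)

lemma finite_part: "finite N \<Longrightarrow> finite (part N a)"
  using finite_arrangements finite_subset part_subset by metis

lemma part_disjoint: "a \<noteq> b \<Longrightarrow> part N a \<inter> part N b = {}" by (auto simp: part_def)

lemma arrangements_eq_Un_part:
  assumes "card N \<ge> 1"
  shows "arrangements N = (\<Union>a\<in>{a. \<bar>a\<bar> \<in> N}. part N a)"
proof
  show "arrangements N \<subseteq> (\<Union>a\<in>{a. \<bar>a\<bar> \<in> N}. part N a)"
    using arrangements_hd_last(2)[OF _ assms] arrangements_nth_mem[of _ N "card N - 1"] assms
    by (auto simp: part_def)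
qed (use part_subset in blast)

lemma append_arrangements_iff:
  assumes "\<bar>a\<bar> \<in> N"
  shows "xs @ [a] \<in> arrangements N \<longleftrightarrow> xs \<in> arrangements (N - {\<bar>a\<bar>})"
proof -
  have "distinct (map abs (xs @ [a])) \<longleftrightarrow> distinct (map abs xs) \<and> \<bar>a\<bar> \<notin> abs ` set xs" by auto
  moreover have "abs ` set (xs @ [a]) = insert \<bar>a\<bar> (abs ` set xs)" by simp
  moreover have "\<bar>a\<bar> \<notin> S \<and> insert \<bar>a\<bar> S = N \<longleftrightarrow> S = N - {\<bar>a\<bar>}" for S
    using assms by auto
  ultimately show ?thesis unfolding arrangements_iff by metis
qed

lemma part_eq_image:
  assumes "\<bar>a\<bar> \<in> N" "card N \<ge> 1"
  shows "part N a = (\<lambda>xs. xs @ [a]) ` arrangements (N - {\<bar>a\<bar>})"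
proof (intro equalityI subsetI)
  fix x assume "x \<in> part N a"
  then have x: "x \<in> arrangements N" "last x = a" "x \<noteq> []"
    using arrangements_hd_last(3)[OF _ assms(2)] by (auto simp: part_def)
  then have "x = butlast x @ [a]" by (metis append_butlast_last_id)
  then show "x \<in> (\<lambda>xs. xs @ [a]) ` arrangements (N - {\<bar>a\<bar>})"
    using x(1) append_arrangements_iff[OF assms(1)] by (metis image_eqI)
qed (auto simp: part_def append_arrangements_iff[OF assms(1)])

lemma inj_append_last: "inj_on (\<lambda>xs. xs @ [a]) X"
  by (auto simp: inj_on_def)

lemma append_arc: "(x, y) \<in> reversal_arcs \<Longrightarrow> (x @ [a], y @ [a]) \<in> reversal_arcs"
  unfolding reversal_arcs_def by (force simp: reversal_append)

lemma card_part_ge: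
  assumes "finite N" "\<And>a. a \<in> N \<Longrightarrow> 0 < a" "\<bar>a\<bar> \<in> N"
  shows "card (part N a) \<ge> card N"
proof -
  have N: "card N \<ge> 1" using assms(1,3) by (metis One_nat_def Suc_leI card_gt_0_iff empty_iff)
  have "card (part N a) = card (arrangements (N - {\<bar>a\<bar>}))"
    unfolding part_eq_image[OF assms(3) N] by (rule card_image[OF inj_append_last])
  also have "\<dots> \<ge> card (N - {\<bar>a\<bar>}) + 1" using assms by (intro card_arrangements_ge) auto
  finally show ?thesis using assms(1,3) N by simp
qed

text \<open>The last symbol of \<open>flip x\<close> is minus the first symbol of \<open>x\<close>.
  Were it \<open>a\<close>, the first and last entries of \<open>x\<close> would agree in absolute
  value.\<close>

lemma flip_not_in_part:
  assumes "x \<in> part N a" "card N \<ge> 2"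
  shows "flip x \<notin> part N a"
proof
  have x: "x \<in> arrangements N" "last x = a" using assms(1) by (auto simp: part_def)
  note hl = arrangements_hd_last[OF x(1)]
  assume "flip x \<in> part N a"
  then have "- hd x = last x" using last_flip[of x] hl(3) x assms(2) by (auto simp: part_def)
  then have h: "- (x ! 0) = x ! (card N - 1)" using hl assms(2) by simp
  have "0 = card N - 1"
    using arg_cong[OF h, of abs] assms(2) by (intro arrangements_nth_abs_eq[OF x(1)]) auto
  then show False using assms(2) by simp
qed

text \<open>All lists \<open>(- b) # xs @ [a]\<close> qualify. The middle \<open>xs\<close> arranges
  \<open>card N - 2\<close> symbols, and the linear bound on arrangements adds one.\<close>

lemma card_crossing_ge:
  assumes "finite N" "\<And>a. a \<in> N \<Longrightarrow> 0 < a" "\<bar>a\<bar> \<in> N" "\<bar>b\<bar> \<in> N" "\<bar>a\<bar> \<noteq> \<bar>b\<bar>"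
  shows "card {x \<in> part N a. flip x \<in> part N b} \<ge> card N - 1"
proof -
  let ?N = "N - {\<bar>a\<bar>, \<bar>b\<bar>}" and ?f = "\<lambda>xs. (- b) # xs @ [a]"
  have "card {\<bar>a\<bar>, \<bar>b\<bar>} = 2" using assms(5) by simp
  moreover have "card {\<bar>a\<bar>, \<bar>b\<bar>} \<le> card N" using assms by (intro card_mono) auto
  moreover have "card ?N = card N - card {\<bar>a\<bar>, \<bar>b\<bar>}" using assms by (intro card_Diff_subset) auto
  ultimately have "card N - 1 = card ?N + 1" by simp
  also have "\<dots> \<le> card (arrangements ?N)" using assms by (intro card_arrangements_ge) auto
  also have "\<dots> = card (?f ` arrangements ?N)" by (subst card_image) (auto simp: inj_on_def)
  also have "\<dots> \<le> card {x \<in> part N a. flip x \<in> part N b}"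
  proof (rule card_mono)
    show "finite {x \<in> part N a. flip x \<in> part N b}" using finite_part[OF assms(1)] by simp
    have "?f xs \<in> part N a \<and> flip (?f xs) \<in> part N b" if xs: "xs \<in> arrangements ?N" for xs
    proof -
      have "\<bar>b\<bar> \<notin> abs ` set xs" "\<bar>a\<bar> \<notin> abs ` set xs" "insert \<bar>b\<bar> (insert \<bar>a\<bar> (abs ` set xs)) = N"
        using xs assms(3,4) by (auto simp: arrangements_iff)
      then have f: "?f xs \<in> arrangements N"
        using xs assms(5) by (simp add: arrangements_iff)
      then show ?thesis using flip_arrangements[OF f] last_flip[of "?f xs"] by (simp add: part_def)
    qed
    then show "?f ` arrangements ?N \<subseteq> {x \<in> part N a. flip x \<in> part N b}" by blast
  qed
  finally show ?thesis .
qed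

text \<open>After the reversal the external neighbour ends in \<open>x ! (i - 1)\<close>. This
  symbol is therefore \<open>a\<close> or \<open>b\<close>, and it is not \<open>last x\<close>
  because it stands at an earlier position; so it is determined.\<close>

lemma flip_reversal_in_parts:
  assumes x: "x \<in> part N a \<union> part N b" and ab: "\<bar>a\<bar> \<noteq> \<bar>b\<bar>"
    and i: "1 \<le> i" "i < card N" and f: "flip (signed_prefix_reversal i x) \<in> part N a \<union> part N b"
  shows "x ! (i - 1) \<in> {a, b} - {last x}"
proof -
  have xN: "x \<in> arrangements N" "last x \<in> {a, b}" using x by (auto simp: part_def)
  note hl = arrangements_hd_last[OF xN(1)] and len = length_arrangements[OF xN(1)]
  have "last (flip (signed_prefix_reversal i x)) = x ! (i - 1)"
    using last_flip[of "signed_prefix_reversal i x"] hd_reversal[of i x] i len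
    by (auto simp flip: length_0_conv)
  then have "x ! (i - 1) \<in> {a, b}" using f by (auto simp: part_def)
  moreover have "x ! (i - 1) \<noteq> last x"
  proof
    assume "x ! (i - 1) = last x"
    then have "i - 1 = card N - 1" using hl(2) i by (intro arrangements_nth_abs_eq[OF xN(1)]) auto
    then show False using i by linarith
  qed
  ultimately show ?thesis by blast
qed

text \<open>
  The reversal of length \<open>i < n\<close> leads to a vertex with external neighbour in part \<open>x ! (i - 1)\<close>, while
  that of \<open>x\<close> lies in part \<open>- (x ! 0)\<close>.
\<close>
lemma no_two_crossings:
  assumes x: "x \<in> part N a \<union> part N b" and ab: "\<bar>a\<bar> \<noteq> \<bar>b\<bar>" and N: "0 \<notin> N"
    and i: "1 \<le> i" "i < card N" and f: "flip (signed_prefix_reversal i x) \<in> part N a \<union> part N b"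
  shows "flip x \<notin> part N a \<union> part N b"
proof
  have xN: "x \<in> arrangements N" "last x \<in> {a, b}" using x by (auto simp: part_def)
  note hl = arrangements_hd_last[OF xN(1)]
  assume "flip x \<in> part N a \<union> part N b"
  then have h: "- (x ! 0) \<in> {a, b}" using last_flip[of x] hl i by (auto simp: part_def)
  have "\<bar>x ! 0\<bar> \<noteq> \<bar>last x\<bar>"
    using arrangements_nth_abs_eq[OF xN(1), of 0 "card N - 1"] i hl(2) by auto
  then have "- (x ! 0) \<in> {a, b} - {last x}" using h by auto
  \<comment> \<open>Both symbols are the one of \<open>a\<close>, \<open>b\<close> other than
    \<open>last x\<close>. Equal absolute values put them at the same position, where the symbol
    would be its own negative.\<close>
  then have eq: "- (x ! 0) = x ! (i - 1)"
    using flip_reversal_in_parts[OF x ab i f] xN(2) by auto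
  then have "0 = i - 1"
    using i arg_cong[OF eq, of abs] by (intro arrangements_nth_abs_eq[OF xN(1)]) auto
  then have "x ! 0 = 0" using eq by simp
  then show False using arrangements_nth_mem[OF xN(1), of 0] N i by simp
qed

text \<open>Supplies the hypothesis \<open>crossing\<close> of \<open>linked_core\<close>: by
  \<open>no_two_crossings\<close> only the full reversal can join two such vertices.\<close>

lemma parts_crossing:
  assumes "\<bar>a\<bar> \<noteq> \<bar>b\<bar>" "0 \<notin> N" "u \<in> part N a \<union> part N b" "(u, v) \<in> reversal_arcs"
    and "flip u \<in> part N a \<union> part N b" "flip v \<in> part N a \<union> part N b"
  shows "v = flip u"
proof -
  have "length u = card N" using assms(3) length_arrangements by (auto simp: part_def)
  then obtain i where i: "1 \<le> i" "i \<le> card N" "v = signed_prefix_reversal i u"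
    using assms(4) by (auto simp: reversal_arcs_def)
  then have "i = card N"
    using no_two_crossings[OF assms(3,1,2), of i] assms(5,6) by fastforce
  then show ?thesis using i \<open>length u = card N\<close> reversal_length by metis
qed

text \<open>Supplies the hypothesis \<open>unique\<close> of \<open>linked_core\<close>. Two shorter
  reversals would select the same symbol of \<open>x\<close>, hence have equal length; a shorter and
  the full one contradict \<open>no_two_crossings\<close>.\<close>

lemma parts_unique_crossing:
  assumes "\<bar>a\<bar> \<noteq> \<bar>b\<bar>" "0 \<notin> N" "x \<in> part N a \<union> part N b"
    and "u \<in> part N a \<union> part N b" "v \<in> part N a \<union> part N b"
    and "(x, u) \<in> reversal_arcs" "(x, v) \<in> reversal_arcs"
    and "flip u \<in> part N a \<union> part N b" "flip v \<in> part N a \<union> part N b"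
  shows "u = v"
proof -
  have xN: "x \<in> arrangements N" "last x \<in> {a, b}" using assms(3) by (auto simp: part_def)
  then have len: "length x = card N" using length_arrangements by blast
  obtain i j where i: "1 \<le> i" "i \<le> card N" "u = signed_prefix_reversal i x"
    and j: "1 \<le> j" "j \<le> card N" "v = signed_prefix_reversal j x"
    using assms(6,7) len by (auto simp: reversal_arcs_def)
  have top: "signed_prefix_reversal (card N) x = flip x" using reversal_length[of x] len by simp
  consider "i = j" | "i < card N" "j = card N" | "i = card N" "j < card N" | "i < card N" "j < card N"
    using i j by linarith
  then show ?thesis
  proof cases
    case 2
    then show ?thesis
      using no_two_crossings[OF assms(3,1,2), of i] i j assms(5,8) top by simp
  next
    case 3
    then show ?thesis
      using no_two_crossings[OF assms(3,1,2), of j] i j assms(4,9) top by simp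
  next
    case 4
    then have "x ! (i - 1) \<in> {a, b} - {last x}" "x ! (j - 1) \<in> {a, b} - {last x}"
      using flip_reversal_in_parts[OF assms(3,1)] i j assms(8,9) by simp_all
    then have "x ! (i - 1) = x ! (j - 1)" using xN(2) by auto
    then have "i - 1 = j - 1" using 4 i j by (intro arrangements_nth_abs_eq[OF xN(1)]) auto
    then have "i = j" using i(1) j(1) by linarith
    then show ?thesis using i(3) j(3) by simp
  qed (use i j in simp)
qed

section \<open>Connectivity of unions of parts\<close>

lemma exists_other_abs:
  assumes "card N \<ge> 2"
  shows "\<exists>b\<in>N. b \<noteq> \<bar>a\<bar>"
proof (rule ccontr)
  assume "\<not> ?thesis"
  then have "N \<subseteq> {\<bar>a\<bar>}" by blast
  then have "card N \<le> card {\<bar>a\<bar>}" by (intro card_mono) auto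
  then show False using assms by simp
qed

text \<open>After fewer than \<open>card N - 1\<close> deletions each part is connected and
  nonempty, and some edge survives between any two parts of different absolute value. Parts of
  \<open>a\<close> and \<open>- a\<close> have no edge between them, hence the demand for a third
  part in \<open>Q\<close>.\<close>

lemma k_connected_UN_part:
  assumes N: "finite N" "\<And>a. a \<in> N \<Longrightarrow> 0 < a" "card N \<ge> 2"
    and parts: "\<And>a. \<bar>a\<bar> \<in> N \<Longrightarrow> k_connected (card N - 1) reversal_arcs (part N a)"
    and Q: "\<And>a. a \<in> Q \<Longrightarrow> \<bar>a\<bar> \<in> N" "\<And>a. a \<in> Q \<Longrightarrow> - a \<in> Q \<Longrightarrow> \<exists>c\<in>Q. \<bar>c\<bar> \<noteq> \<bar>a\<bar>"
  shows "k_connected (card N - 1) reversal_arcs (\<Union>a\<in>Q. part N a)"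
  unfolding k_connected_def
proof (intro allI impI)
  fix F :: "int list set" assume F: "finite F" "card F < card N - 1"
  show "conn_on reversal_arcs ((\<Union>a\<in>Q. part N a) - F)"
  proof (rule conn_on_UN[OF sym_reversal_arcs, where R = "\<lambda>a b. \<bar>a\<bar> \<noteq> \<bar>b\<bar>"])
    fix a assume a: "a \<in> Q"
    show "part N a - F \<noteq> {}"
    proof
      assume "part N a - F = {}"
      then have "card (part N a) \<le> card F" using F(1) by (intro card_mono) auto
      then show False using card_part_ge[OF N(1,2) Q(1)[OF a]] F(2) by simp
    qed
    show "conn_on reversal_arcs (part N a - F)"
      using k_connectedD[OF parts[OF Q(1)[OF a]] F] .
  next
    fix a b assume ab: "a \<in> Q" "b \<in> Q" "\<bar>a\<bar> \<noteq> \<bar>b\<bar>"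
    show "conn_on reversal_arcs ((part N a \<union> part N b) - F)"
    proof (rule conn_on_glue[OF sym_reversal_arcs _ _ _ _ _ _ F(1), where g = flip and M = "{x \<in> part N a. flip x \<in> part N b}"])
      show "conn_on reversal_arcs (part N a - F)" "conn_on reversal_arcs (part N b - F)"
        using k_connectedD[OF parts[OF Q(1)] F] ab by auto
      show "part N a \<inter> part N b = {}" using ab(3) by (intro part_disjoint) auto
      show "inj_on flip {x \<in> part N a. flip x \<in> part N b}" using inj_flip by (rule inj_on_subset) simp
      show "card F < card {x \<in> part N a. flip x \<in> part N b}"
        using card_crossing_ge[OF N(1,2) Q(1)[OF ab(1)] Q(1)[OF ab(2)] ab(3)] F(2) by simp
      show "(u, flip u) \<in> reversal_arcs" if "u \<in> {x \<in> part N a. flip x \<in> part N b}" for u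
        using that arrangements_hd_last(3)[of u N] N(3) by (intro flip_arc) (auto simp: part_def)
    qed auto
  next
    fix a b assume ab: "a \<in> Q" "b \<in> Q"
    show "a = b \<or> \<bar>a\<bar> \<noteq> \<bar>b\<bar> \<or> (\<exists>c\<in>Q. \<bar>a\<bar> \<noteq> \<bar>c\<bar> \<and> \<bar>c\<bar> \<noteq> \<bar>b\<bar>)"
    proof (cases "a = b \<or> \<bar>a\<bar> \<noteq> \<bar>b\<bar>")
      case False
      then have "b = - a" by linarith
      then obtain c where "c \<in> Q" "\<bar>c\<bar> \<noteq> \<bar>a\<bar>" using Q(2) ab by blast
      then show ?thesis using \<open>b = - a\<close> by (intro disjI2 bexI[of _ c]) auto
    qed auto
  qed
qed

lemma arrangements_minus_parts:
  assumes "card N \<ge> 1"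
  shows "arrangements N - (\<Union>a\<in>I. part N a) = (\<Union>a\<in>{a. \<bar>a\<bar> \<in> N} - I. part N a)"
  using arrangements_eq_Un_part[OF assms] by (auto simp: part_def)

lemma k_connected_minus_part:
  assumes N: "finite N" "\<And>a. a \<in> N \<Longrightarrow> 0 < a" "card N \<ge> 2"
    and parts: "\<And>a. \<bar>a\<bar> \<in> N \<Longrightarrow> k_connected (card N - 1) reversal_arcs (part N a)"
  shows "k_connected (card N - 1) reversal_arcs (arrangements N - part N i)"
proof -
  have "k_connected (card N - 1) reversal_arcs (\<Union>a\<in>{a. \<bar>a\<bar> \<in> N} - {i}. part N a)"
  proof (rule k_connected_UN_part[OF N parts])
    fix a assume "a \<in> {a. \<bar>a\<bar> \<in> N} - {i}"
    obtain b where b: "b \<in> N" "b \<noteq> \<bar>a\<bar>" using exists_other_abs[OF N(3)] by blast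
    then have "0 < b" using N(2) by blast
    \<comment> \<open>Only the part of \<open>i\<close> is missing, so one of \<open>b\<close> and
      \<open>- b\<close> is still available.\<close>
    define c where "c = (if b = i then - b else b)"
    have "c \<in> {a. \<bar>a\<bar> \<in> N} - {i}" "\<bar>c\<bar> \<noteq> \<bar>a\<bar>" using b \<open>0 < b\<close> by (auto simp: c_def)
    then show "\<exists>c\<in>{a. \<bar>a\<bar> \<in> N} - {i}. \<bar>c\<bar> \<noteq> \<bar>a\<bar>" by blast
  qed auto
  then show ?thesis using arrangements_minus_parts[of N "{i}"] N(3) by simp
qed

lemma k_connected_minus_two_parts:
  assumes N: "finite N" "\<And>a. a \<in> N \<Longrightarrow> 0 < a" "card N \<ge> 2"
    and parts: "\<And>a. \<bar>a\<bar> \<in> N \<Longrightarrow> k_connected (card N - 1) reversal_arcs (part N a)"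
    and ab: "\<bar>a\<bar> \<in> N" "\<bar>b\<bar> \<in> N" "\<bar>a\<bar> \<noteq> \<bar>b\<bar>"
  shows "k_connected (card N - 1) reversal_arcs (arrangements N - (part N a \<union> part N b))"
proof -
  have "a \<noteq> 0" "b \<noteq> 0" using N(2)[OF ab(1)] N(2)[OF ab(2)] by auto
  have "k_connected (card N - 1) reversal_arcs (\<Union>c\<in>{c. \<bar>c\<bar> \<in> N} - {a, b}. part N c)"
  proof (rule k_connected_UN_part[OF N parts])
    fix c assume "c \<in> {c. \<bar>c\<bar> \<in> N} - {a, b}"
    \<comment> \<open>The parts of \<open>- a\<close> and \<open>- b\<close> remain and differ in
      absolute value, so one of them differs from that of \<open>c\<close>. For
      \<open>card N = 2\<close> these are all the remaining parts.\<close>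
    have "- a \<in> {c. \<bar>c\<bar> \<in> N} - {a, b}" "- b \<in> {c. \<bar>c\<bar> \<in> N} - {a, b}"
      using ab \<open>a \<noteq> 0\<close> \<open>b \<noteq> 0\<close> by auto
    moreover have "\<bar>- a\<bar> \<noteq> \<bar>c\<bar> \<or> \<bar>- b\<bar> \<noteq> \<bar>c\<bar>" using ab(3) by auto
    ultimately show "\<exists>d\<in>{c. \<bar>c\<bar> \<in> N} - {a, b}. \<bar>d\<bar> \<noteq> \<bar>c\<bar>" by blast
  qed auto
  then show ?thesis using arrangements_minus_parts[of N "{a, b}"] N(3) by simp
qed

lemma k_connected_part_Un_part:
  assumes N: "finite N" "\<And>a. a \<in> N \<Longrightarrow> 0 < a" "card N \<ge> 2"
    and parts: "\<And>a. \<bar>a\<bar> \<in> N \<Longrightarrow> k_connected (card N - 1) reversal_arcs (part N a)"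
    and ab: "\<bar>a\<bar> \<in> N" "\<bar>b\<bar> \<in> N" "\<bar>a\<bar> \<noteq> \<bar>b\<bar>"
  shows "k_connected (card N - 1) reversal_arcs (part N a \<union> part N b)"
proof -
  have "k_connected (card N - 1) reversal_arcs (\<Union>c\<in>{a, b}. part N c)"
  proof (rule k_connected_UN_part[OF N parts])
    fix c assume "c \<in> {a, b}"
    then show "\<exists>d\<in>{a, b}. \<bar>d\<bar> \<noteq> \<bar>c\<bar>" using ab(3) by auto
  qed (use ab in auto)
  then show ?thesis by simp
qed

text \<open>
  If fewer than \<open>n\<close> vertices are deleted, all parts other than that of some deleted vertex
  together lose fewer than \<open>n - 1\<close> vertices and remain connected to each other.
\<close>
theorem k_connected_arrangements:
  assumes "finite N" "\<And>a. a \<in> N \<Longrightarrow> 0 < a"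
  shows "k_connected (card N) reversal_arcs (arrangements N)"
  using assms
proof (induction "card N" arbitrary: N rule: less_induct)
  case less
  note N = less.prems
  have parts: "k_connected (card N - 1) reversal_arcs (part N a)" if a: "\<bar>a\<bar> \<in> N" for a
  proof -
    have N1: "card N \<ge> 1" using a N(1) by (metis One_nat_def Suc_leI card_gt_0_iff empty_iff)
    have "card (N - {\<bar>a\<bar>}) = card N - 1" using a N(1) by simp
    then have "k_connected (card N - 1) reversal_arcs (arrangements (N - {\<bar>a\<bar>}))"
      using less.hyps[of "N - {\<bar>a\<bar>}"] N N1 by simp
    then show ?thesis
      unfolding part_eq_image[OF a N1]
      by (rule k_connected_image) (auto intro: inj_append_last append_arc)
  qed
  show ?case
    unfolding k_connected_def
  proof (intro allI impI)
    fix F :: "int list set" assume F: "finite F" "card F < card N"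
    consider "card N = 1" | "card N \<ge> 2" using F(2) by linarith
    then show "conn_on reversal_arcs (arrangements N - F)"
    proof cases
      case 1
      then have "F = {}" using F by simp
      have arr: "y = x \<or> y = flip x" if xy: "x \<in> arrangements N" "y \<in> arrangements N" for x y
      proof -
        from 1 obtain c where "N = {c}" by (auto simp: card_1_singleton_iff)
        moreover obtain a where "x = [a]"
          using length_arrangements[OF xy(1)] 1 by (auto simp: length_Suc_conv)
        moreover obtain b where "y = [b]"
          using length_arrangements[OF xy(2)] 1 by (auto simp: length_Suc_conv)
        ultimately have "\<bar>a\<bar> = \<bar>b\<bar>" using xy by (simp add: arrangements_iff)
        then show ?thesis using \<open>x = [a]\<close> \<open>y = [b]\<close> by (auto simp: flip_def)
      qed
      have "(x, y) \<in> (reversal_arcs \<inter> arrangements N \<times> arrangements N)\<^sup>*"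
        if "x \<in> arrangements N" "y \<in> arrangements N" for x y
        using arr[OF that] that flip_arc[of x] arrangements_hd_last(3)[OF that(1)] 1 by auto
      then show ?thesis unfolding \<open>F = {}\<close> conn_on_def by simp
    next
      case 2
      note rest = k_connected_minus_part[OF N 2 parts]
      show ?thesis
      proof (cases "F \<inter> arrangements N = {}")
        case True
        have "k_connected (card N - 1) reversal_arcs (\<Union>a\<in>{a. \<bar>a\<bar> \<in> N}. part N a)"
        proof (rule k_connected_UN_part[OF N 2 parts])
          fix a assume "a \<in> {a. \<bar>a\<bar> \<in> N}"
          obtain b where b: "b \<in> N" "b \<noteq> \<bar>a\<bar>" using exists_other_abs[OF 2] by blast
          then have "\<bar>b\<bar> = b" using N(2)[OF b(1)] by simp
          then show "\<exists>c\<in>{a. \<bar>a\<bar> \<in> N}. \<bar>c\<bar> \<noteq> \<bar>a\<bar>" using b by (intro bexI[of _ b]) auto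
        qed auto
        moreover have "(\<Union>a\<in>{a. \<bar>a\<bar> \<in> N}. part N a) = arrangements N"
          by (rule arrangements_eq_Un_part[symmetric]) (use 2 in simp)
        ultimately have "k_connected (card N - 1) reversal_arcs (arrangements N)" by (simp only:)
        then have "conn_on reversal_arcs (arrangements N - {})"
          by (rule k_connectedD) (use 2 in simp_all)
        moreover have "arrangements N - F = arrangements N" using True by blast
        ultimately show ?thesis by simp
      next
        case False
        then obtain f where f: "f \<in> F" "f \<in> arrangements N" by blast
        define X where "X = part N (last f)"
        define Y where "Y = arrangements N - X"
        have XY: "X \<union> Y = arrangements N" "X \<inter> Y = {}" using part_subset by (auto simp: X_def Y_def)
        have fX: "f \<in> X" using f by (simp add: X_def part_def)
        have i: "\<bar>last f\<bar> \<in> N"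
          using arrangements_hd_last(2)[OF f(2)] arrangements_nth_mem[OF f(2), of "card N - 1"] 2 by simp
        have finX: "finite X" unfolding X_def by (rule finite_part[OF N(1)])
        have flip_out: "flip x \<in> Y" "(x, flip x) \<in> reversal_arcs" if "x \<in> X" for x
        proof -
          have "x \<in> arrangements N" using that part_subset by (auto simp: X_def)
          then show "flip x \<in> Y" using flip_not_in_part[of x N "last f"] that 2 flip_arrangements
            by (auto simp: X_def Y_def)
          show "(x, flip x) \<in> reversal_arcs"
            using arrangements_hd_last(3)[OF \<open>x \<in> arrangements N\<close>] 2 by (intro flip_arc) simp
        qed
        have "Suc (card (F - {f})) = card F" using f(1) F(1) by (rule card_Suc_Diff1[rotated])
        then have cF: "card (F - {f}) < card N - 1" using F(2) by linarith
        have kY: "k_connected (card N - 1) reversal_arcs Y"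
          unfolding Y_def X_def by (rule rest)
        have "conn_on reversal_arcs (Y - (F - {f}))"
          by (rule k_connectedD[OF kY _ cF]) (use F(1) in simp)
        moreover have "Y - (F - {f}) = Y - F" using fX XY(2) by blast
        ultimately have connY: "conn_on reversal_arcs (Y - F)" by simp
        show ?thesis
        proof (cases "card (F \<inter> X) < card N - 1")
          case True
          have "conn_on reversal_arcs (X - F \<inter> X)"
            using k_connectedD[OF parts[OF i] _ True] F(1) by (simp add: X_def)
          moreover have "X - F \<inter> X = X - F" by blast
          ultimately have connX: "conn_on reversal_arcs (X - F)" by simp
          \<comment> \<open>The matching by \<open>flip\<close> covers all of \<open>X\<close>,
            which has at least \<open>card N\<close> vertices.\<close>
          have "card F < card X" using card_part_ge[OF N i] F(2) by (simp add: X_def)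
          then have "conn_on reversal_arcs ((X \<union> Y) - F)"
            using flip_out inj_on_subset[OF inj_flip]
            by (intro conn_on_glue[OF sym_reversal_arcs connX connY XY(2) subset_refl _ _ F(1), where g = flip]) auto
          then show ?thesis using XY(1) by simp
        next
          case False
          \<comment> \<open>All deletions now fall into \<open>X\<close>. The rest of
            \<open>X\<close> may be disconnected, but each of its vertices has its external
            neighbour in the intact \<open>Y\<close>.\<close>
          then have "card F \<le> card (F \<inter> X)" using F(2) by linarith
          then have "F \<inter> X = F" using F(1) by (intro card_seteq) auto
          then have "Y - F = Y" using XY(2) by blast
          have "conn_on reversal_arcs ((X - F) \<union> (Y - F))"
          proof (rule conn_on_attach[OF sym_reversal_arcs connY])
            fix x assume "x \<in> X - F"
            then show "\<exists>y\<in>Y - F. (y, x) \<in> reversal_arcs"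
              using flip_out[of x] symD[OF sym_reversal_arcs] unfolding \<open>Y - F = Y\<close> by blast
          qed
          moreover have "(X - F) \<union> (Y - F) = arrangements N - F" using XY(1) by blast
          ultimately show ?thesis by simp
        qed
      qed
    qed
  qed
qed

corollary k_connected_part:
  assumes "finite N" "\<And>a. a \<in> N \<Longrightarrow> 0 < a" "\<bar>a\<bar> \<in> N"
  shows "k_connected (card N - 1) reversal_arcs (part N a)"
proof -
  have N1: "card N \<ge> 1" using assms(1,3) by (metis One_nat_def Suc_leI card_gt_0_iff empty_iff)
  have "k_connected (card (N - {\<bar>a\<bar>})) reversal_arcs (arrangements (N - {\<bar>a\<bar>}))"
  proof (rule k_connected_arrangements)
    show "0 < b" if "b \<in> N - {\<bar>a\<bar>}" for b using that assms(2)[of b] by simp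
  qed (use assms(1) in simp)
  moreover have "card (N - {\<bar>a\<bar>}) = card N - 1" using assms(1,3) by simp
  ultimately have "k_connected (card N - 1) reversal_arcs (arrangements (N - {\<bar>a\<bar>}))"
    by (simp only:)
  then show ?thesis
    unfolding part_eq_image[OF assms(3) N1]
    by (rule k_connected_image) (auto intro: inj_append_last append_arc)
qed

section \<open>Linking three vertices of the whole graph\<close>

lemma part_abs_mem:
  assumes "x \<in> part N a" "card N \<ge> 1"
  shows "\<bar>a\<bar> \<in> N"
proof -
  have x: "x \<in> arrangements N" "last x = a" using assms(1) by (auto simp: part_def)
  show ?thesis
    using arrangements_nth_mem[OF x(1), of "card N - 1"] arrangements_hd_last(2)[OF x(1) assms(2)] x(2) assms(2)
    by simp
qed

text \<open>With a single part as \<open>A\<close> every external neighbour lies in the complement,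
  so both hypotheses on crossings hold vacuously. The reversals of \<open>x\<close> shorter than the
  full one supply the degree bound for adjacent \<open>x\<close> and \<open>y\<close>.\<close>

lemma linked_two_in_part:
  assumes N: "finite N" "\<And>a. a \<in> N \<Longrightarrow> 0 < a" "card N \<ge> 2"
    and xyz: "x \<in> part N a" "y \<in> part N a" "x \<noteq> y" "z \<in> arrangements N - part N a"
  shows "linked reversal_arcs (arrangements N) {x, y, z} (card N - 1)"
proof -
  let ?A = "part N a" and ?C = "arrangements N - part N a"
  have "0 \<notin> N" using N(2) by blast
  have a: "\<bar>a\<bar> \<in> N" using part_abs_mem[OF xyz(1)] N(3) by simp
  have un: "?A \<union> ?C = arrangements N" using part_subset by blast
  have flip: "flip u \<in> ?C" "(u, flip u) \<in> reversal_arcs" if "u \<in> ?A" for u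
  proof -
    have "u \<in> arrangements N" using that part_subset by blast
    then show "flip u \<in> ?C" using flip_not_in_part[OF that N(3)] flip_arrangements by simp
    show "(u, flip u) \<in> reversal_arcs"
      using arrangements_hd_last(3)[OF \<open>u \<in> arrangements N\<close>] N(3) by (intro flip_arc) simp
  qed
  have x: "x \<in> arrangements N" "last x = a" using xyz(1) by (auto simp: part_def)
  have deg: "card N - 1 \<le> card (reversal_arcs `` {x} \<inter> ?A)"
  proof -
    have "card ((\<lambda>i. signed_prefix_reversal i x) ` {1..card N - 1}) = card N - 1"
      using inj_on_subset[OF inj_on_reversal[OF x(1) \<open>0 \<notin> N\<close>], of "{1..card N - 1}"]
      by (subst card_image) auto
    moreover have "(\<lambda>i. signed_prefix_reversal i x) ` {1..card N - 1} \<subseteq> reversal_arcs `` {x} \<inter> ?A"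
    proof safe
      fix i assume i: "i \<in> {1..card N - 1}"
      then have "1 \<le> i" "i < length x" using length_arrangements[OF x(1)] N(3) by auto
      then show "(x, signed_prefix_reversal i x) \<in> reversal_arcs" "signed_prefix_reversal i x \<in> ?A"
        using reversal_arcsI[of i x] last_reversal[of i x] reversal_arrangements[OF x(1), of i] x(2)
        by (auto simp: part_def)
    qed
    moreover have "finite (reversal_arcs `` {x} \<inter> ?A)" using finite_part[OF N(1)] by simp
    ultimately show ?thesis by (metis card_mono)
  qed
  have "linked reversal_arcs (?A \<union> ?C) {x, y, z} (card N - 1)"
  proof (rule linked_core[where g = flip])
    show "(v, v) \<notin> reversal_arcs" if "v \<in> ?A \<union> ?C" for v
      using that no_loops[OF _ \<open>0 \<notin> N\<close>] unfolding un by blast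
    show "finite ?A" "finite ?C" using finite_part[OF N(1)] finite_arrangements[OF N(1)] by simp_all
    show "k_connected (card N - 1) reversal_arcs ?A" by (rule k_connected_part[OF N(1,2) a])
    show "k_connected (card N - 1) reversal_arcs ?C"
      by (rule k_connected_minus_part[OF N k_connected_part[OF N(1,2)]])
    show "(u, flip u) \<in> reversal_arcs \<and> flip u \<in> ?A \<union> ?C \<and> flip (flip u) = u" if "u \<in> ?A" for u
      using flip[OF that] by simp
    show "flip ` ?A \<subseteq> ?C \<and> card N - 1 \<le> card (reversal_arcs `` {x} \<inter> ?A)"
      using flip(1) deg by blast
  next
    fix u v
    assume "u \<in> ?A" "flip u \<in> ?A"
    then show "v = flip u" "u = v" using flip(1) by blast+
  next
    show "sym reversal_arcs" by (rule sym_reversal_arcs)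
    show "?A \<inter> ?C = {}" by blast
    show "1 \<le> card N - 1" using N(3) by linarith
    show "x \<in> ?A" "y \<in> ?A" "x \<noteq> y" "z \<in> ?C" by (fact xyz)+
  qed
  then show ?thesis unfolding un .
qed

text \<open>Vertices with different last symbols are adjacent only through the full reversal. Hence
  \<open>y \<noteq> flip x\<close> makes \<open>x\<close> and \<open>y\<close> non-adjacent, and the
  hypothesis \<open>adjacent\<close> of \<open>linked_core\<close> holds vacuously.\<close>

lemma linked_two_parts:
  assumes N: "finite N" "\<And>a. a \<in> N \<Longrightarrow> 0 < a" "card N \<ge> 2"
    and xy: "x \<in> part N a" "y \<in> part N b" "\<bar>a\<bar> \<noteq> \<bar>b\<bar>" "y \<noteq> flip x"
    and z: "z \<in> arrangements N - (part N a \<union> part N b)"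
  shows "linked reversal_arcs (arrangements N) {x, y, z} (card N - 1)"
proof -
  let ?A = "part N a \<union> part N b" and ?C = "arrangements N - (part N a \<union> part N b)"
  have "0 \<notin> N" using N(2) by blast
  have ab: "\<bar>a\<bar> \<in> N" "\<bar>b\<bar> \<in> N" using part_abs_mem xy N(3) by auto
  have un: "?A \<union> ?C = arrangements N" using part_subset by blast
  have flip: "flip u \<in> ?A \<union> ?C" "(u, flip u) \<in> reversal_arcs" if "u \<in> ?A" for u
  proof -
    have "u \<in> arrangements N" using that part_subset by blast
    then show "flip u \<in> ?A \<union> ?C" unfolding un by (rule flip_arrangements)
    show "(u, flip u) \<in> reversal_arcs"
      using arrangements_hd_last(3)[OF \<open>u \<in> arrangements N\<close>] N(3) by (intro flip_arc) simp
  qed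
  have "x \<noteq> y" using xy by (auto simp: part_def)
  have nonadj: "(x, y) \<notin> reversal_arcs"
  proof
    assume "(x, y) \<in> reversal_arcs"
    then obtain i where i: "1 \<le> i" "i \<le> length x" "y = signed_prefix_reversal i x"
      by (auto simp: reversal_arcs_def)
    then have "i < length x" using xy(4) reversal_length[of x] by (cases "i = length x") auto
    then have "last y = last x" using i(3) last_reversal by simp
    then show False using xy by (auto simp: part_def)
  qed
  have "linked reversal_arcs (?A \<union> ?C) {x, y, z} (card N - 1)"
  proof (rule linked_core[where g = flip])
    show "(v, v) \<notin> reversal_arcs" if "v \<in> ?A \<union> ?C" for v
      using that no_loops[OF _ \<open>0 \<notin> N\<close>] unfolding un by blast
    show "finite ?A" "finite ?C" using finite_part[OF N(1)] finite_arrangements[OF N(1)] by simp_all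
    show "k_connected (card N - 1) reversal_arcs ?A"
      by (rule k_connected_part_Un_part[OF N k_connected_part[OF N(1,2)] ab xy(3)])
    show "k_connected (card N - 1) reversal_arcs ?C"
      by (rule k_connected_minus_two_parts[OF N k_connected_part[OF N(1,2)] ab xy(3)])
    show "(u, flip u) \<in> reversal_arcs \<and> flip u \<in> ?A \<union> ?C \<and> flip (flip u) = u" if "u \<in> ?A" for u
      using flip[OF that] by simp
  next
    fix u v
    assume "u \<in> ?A" "v \<in> ?A" "(u, v) \<in> reversal_arcs" "flip u \<in> ?A" "flip v \<in> ?A"
    then show "v = flip u" using parts_crossing[OF xy(3) \<open>0 \<notin> N\<close>] by blast
  next
    fix u v
    assume "u \<in> ?A" "v \<in> ?A" "(x, u) \<in> reversal_arcs" "(x, v) \<in> reversal_arcs" "flip u \<in> ?A" "flip v \<in> ?A"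
    then show "u = v" using parts_unique_crossing[OF xy(3) \<open>0 \<notin> N\<close>, of x u v] xy(1) by blast
  next
    show "sym reversal_arcs" by (rule sym_reversal_arcs)
    show "?A \<inter> ?C = {}" by blast
    show "1 \<le> card N - 1" using N(3) by linarith
    show "x \<in> ?A" "y \<in> ?A" using xy(1,2) by simp_all
    show "x \<noteq> y" "z \<in> ?C" by (fact \<open>x \<noteq> y\<close> z)+
    show "flip ` ?A \<subseteq> ?C \<and> card N - 1 \<le> card (reversal_arcs `` {x} \<inter> ?A)" if "(x, y) \<in> reversal_arcs"
      using nonadj that by blast
  qed
  then show ?thesis unfolding un .
qed

lemma linked_two_same_last:
  assumes N: "finite N" "\<And>a. a \<in> N \<Longrightarrow> 0 < a" "card N \<ge> 2"
    and "x \<in> arrangements N" "y \<in> arrangements N" "z \<in> arrangements N" "x \<noteq> y"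
    and "last x = last y" "last z \<noteq> last x"
  shows "linked reversal_arcs (arrangements N) {x, y, z} (card N - 1)"
  by (rule linked_two_in_part[OF N, where a = "last x"]) (use assms(4-) in \<open>auto simp: part_def\<close>)

text \<open>Of the three pairs, at most one agrees in the absolute value of the last symbol and at
  most one is exchanged by the involution \<open>flip\<close>, so a pair suitable for
  \<open>linked_two_parts\<close> remains.\<close>

lemma linked_distinct_lasts:
  assumes N: "finite N" "\<And>a. a \<in> N \<Longrightarrow> 0 < a" "card N \<ge> 2"
    and xyz: "x \<in> arrangements N" "y \<in> arrangements N" "z \<in> arrangements N"
    and d: "last x \<noteq> last y" "last x \<noteq> last z" "last y \<noteq> last z"
  shows "linked reversal_arcs (arrangements N) {x, y, z} (card N - 1)"
proof -
  have L: "linked reversal_arcs (arrangements N) {u, v, w} (card N - 1)"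
    if "u \<in> arrangements N" "v \<in> arrangements N" "w \<in> arrangements N"
      "last w \<noteq> last u" "last w \<noteq> last v" "\<bar>last u\<bar> \<noteq> \<bar>last v\<bar>" "v \<noteq> flip u" for u v w
    by (rule linked_two_parts[OF N, where a = "last u" and b = "last v"]) (use that in \<open>auto simp: part_def\<close>)
  have abs: "\<not> (\<bar>last x\<bar> = \<bar>last y\<bar> \<and> \<bar>last x\<bar> = \<bar>last z\<bar>)"
    "\<not> (\<bar>last x\<bar> = \<bar>last y\<bar> \<and> \<bar>last y\<bar> = \<bar>last z\<bar>)"
    "\<not> (\<bar>last x\<bar> = \<bar>last z\<bar> \<and> \<bar>last y\<bar> = \<bar>last z\<bar>)"
    using d by linarith+
  have flips: "\<not> (y = flip x \<and> z = flip x)" "\<not> (y = flip x \<and> z = flip y)" "\<not> (z = flip x \<and> z = flip y)"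
    using d injD[OF inj_flip, of x y] by auto
  have ne: "last y \<noteq> last x" "last z \<noteq> last x" "last z \<noteq> last y" using d by simp_all
  consider "\<bar>last x\<bar> \<noteq> \<bar>last y\<bar>" "y \<noteq> flip x" | "\<bar>last x\<bar> \<noteq> \<bar>last z\<bar>" "z \<noteq> flip x"
    | "\<bar>last y\<bar> \<noteq> \<bar>last z\<bar>" "z \<noteq> flip y"
    using abs flips by argo
  then show ?thesis
  proof cases
    case 1
    show ?thesis by (rule L[OF xyz ne(2,3) 1])
  next
    case 2
    have "linked reversal_arcs (arrangements N) {x, z, y} (card N - 1)"
      by (rule L[OF xyz(1,3,2) ne(1) d(3) 2])
    then show ?thesis by (simp add: insert_commute)
  next
    case 3
    have "linked reversal_arcs (arrangements N) {y, z, x} (card N - 1)"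
      by (rule L[OF xyz(2,3,1) d(1,2) 3])
    then show ?thesis by (simp add: insert_commute)
  qed
qed

text \<open>The complement of the part is connected, and each vertex of \<open>S\<close> is attached
  to it through its own \<open>flip\<close>, without arcs inside \<open>S\<close>.\<close>

lemma linked_all_in_part:
  assumes N: "finite N" "\<And>a. a \<in> N \<Longrightarrow> 0 < a" "card N \<ge> 2" and a: "\<bar>a\<bar> \<in> N"
    and S: "S \<subseteq> part N a" and r: "linked reversal_arcs (part N a) S r"
  shows "linked reversal_arcs (arrangements N) S (Suc r)"
proof (rule linked_Suc[OF r sym_reversal_arcs, where V' = "S \<union> (arrangements N - part N a)"])
  let ?C = "arrangements N - part N a" and ?E = "reversal_arcs - S \<times> S"
  have "conn_on reversal_arcs (?C - {})"
    by (rule k_connectedD[OF k_connected_minus_part[OF N k_connected_part[OF N(1,2)]]]) (use N(3) in simp_all)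
  then have "conn_on reversal_arcs ?C" by simp
  then have "conn_on ?E ?C" by (rule conn_on_mono) (use S in auto)
  moreover have "sym ?E" using sym_reversal_arcs by (auto simp: sym_def)
  moreover have "\<exists>y\<in>?C. (y, x) \<in> ?E" if "x \<in> S" for x
  proof (rule bexI[of _ "flip x"])
    have x: "x \<in> part N a" "x \<in> arrangements N" using that S part_subset by blast+
    show C: "flip x \<in> ?C" using flip_not_in_part[OF x(1) N(3)] flip_arrangements[OF x(2)] by simp
    have "(x, flip x) \<in> reversal_arcs"
      using arrangements_hd_last(3)[OF x(2)] N(3) by (intro flip_arc) simp
    then show "(flip x, x) \<in> ?E" using symD[OF sym_reversal_arcs] C S by blast
  qed
  ultimately show "conn_on ?E (S \<union> ?C)" by (intro conn_on_attach)
qed (use S part_subset in auto)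

theorem linked_arrangements:
  assumes "finite N" "\<And>a. a \<in> N \<Longrightarrow> 0 < a" "card N \<ge> 2" "S \<subseteq> arrangements N" "card S = 3"
  shows "linked reversal_arcs (arrangements N) S (card N - 1)"
  using assms
proof (induction "card N" arbitrary: N S rule: less_induct)
  case less
  note N = less.prems(1-3) and S = less.prems(4)
  obtain x y z where xyz: "S = {x, y, z}" "x \<noteq> y" "x \<noteq> z" "y \<noteq> z"
    using less.prems(5) by (auto simp: card_3_iff)
  have mem: "x \<in> arrangements N" "y \<in> arrangements N" "z \<in> arrangements N" using S xyz(1) by auto
  consider "card N = 2" | "last x = last y" "last y = last z" "card N \<ge> 3"
    | "last x = last y" "last z \<noteq> last x" | "last x = last z" "last y \<noteq> last x"
    | "last y = last z" "last x \<noteq> last y" | "last x \<noteq> last y" "last x \<noteq> last z" "last y \<noteq> last z"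
    using N(3) by linarith
  then show ?case
  proof cases
    case 1
    \<comment> \<open>For two symbols one connected set is enough, and the whole graph serves. The
      descent to a part thus never reaches a one-symbol alphabet.\<close>
    have "conn_on reversal_arcs (arrangements N - {})"
      by (rule k_connectedD[OF k_connected_arrangements[OF N(1,2)]]) (use N(3) in simp_all)
    then have c: "conn_on (reversal_arcs \<inter> arrangements N \<times> arrangements N) (arrangements N)"
      using conn_on_mono by (metis Diff_empty order_refl)
    have "linked reversal_arcs (arrangements N) S 1"
      unfolding linked_def
      by (rule exI[of _ "\<lambda>i. arrangements N"], rule exI[of _ "\<lambda>i. reversal_arcs \<inter> arrangements N \<times> arrangements N"])
        (use c S sym_reversal_arcs in \<open>auto simp: sym_def\<close>)
    then show ?thesis using 1 by simp
  next
    case 2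
    let ?a = "last x"
    let ?N = "N - {\<bar>?a\<bar>}" and ?f = "\<lambda>xs. xs @ [?a]"
    have Sp: "S \<subseteq> part N ?a" using 2 xyz(1) mem by (auto simp: part_def)
    have N1: "card N \<ge> 1" using N(3) by simp
    have a: "\<bar>?a\<bar> \<in> N" using part_abs_mem[of x N ?a] Sp xyz(1) N1 by auto
    define S' where "S' = {u \<in> arrangements ?N. ?f u \<in> S}"
    have S': "S' \<subseteq> arrangements ?N" "?f ` S' = S"
      using Sp unfolding part_eq_image[OF a N1] by (auto simp: S'_def)
    have "card S' = card (?f ` S')" by (rule card_image[OF inj_append_last, symmetric])
    then have "card S' = 3" using S'(2) less.prems(5) by simp
    moreover have cN: "card ?N = card N - 1" using a N(1) by simp
    ultimately have "linked reversal_arcs (arrangements ?N) S' (card ?N - 1)"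
      using N 2(3) S'(1) by (intro less.hyps) auto
    then have "linked reversal_arcs (?f ` arrangements ?N) (?f ` S') (card ?N - 1)"
      by (rule linked_image[OF _ inj_append_last S'(1)]) (rule append_arc)
    then have "linked reversal_arcs (part N ?a) S (card ?N - 1)"
      unfolding part_eq_image[OF a N1] S'(2) .
    then have "linked reversal_arcs (arrangements N) S (Suc (card ?N - 1))"
      by (rule linked_all_in_part[OF N(1) _ N(3) a Sp, rotated]) (rule N(2))
    \<comment> \<open>The part contributes \<open>card N - 2\<close> members and the other parts one
      more; \<open>card N \<ge> 3\<close> makes the subtraction exact.\<close>
    moreover have "Suc (card ?N - 1) = card N - 1" using cN 2(3) by linarith
    ultimately show ?thesis by (simp only:)
  next
    case 3
    then show ?thesis unfolding xyz(1) using xyz mem by (intro linked_two_same_last[OF N]) auto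
  next
    case 4
    then have "linked reversal_arcs (arrangements N) {x, z, y} (card N - 1)"
      using xyz mem by (intro linked_two_same_last[OF N]) auto
    then show ?thesis unfolding xyz(1) by (simp add: insert_commute)
  next
    case 5
    then have "linked reversal_arcs (arrangements N) {y, z, x} (card N - 1)"
      using xyz mem by (intro linked_two_same_last[OF N]) auto
    then show ?thesis unfolding xyz(1) by (simp add: insert_commute)
  next
    case 6
    then show ?thesis unfolding xyz(1) using mem by (intro linked_distinct_lasts[OF N]) auto
  qed
qed

section \<open>Spanning trees and the upper bound\<close>

lemma pcas_last_in_verts: "pcas v es w \<Longrightarrow> w \<in> set (pawalk_verts v es)"
  by (induction es arbitrary: v) auto

lemma pcas_fst_in_verts: "(s, t) \<in> set es \<Longrightarrow> s \<in> set (pawalk_verts v es)"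
  by (induction es arbitrary: v) auto

lemma pcas_snd_in_verts: "pcas v es w \<Longrightarrow> (s, t) \<in> set es \<Longrightarrow> t \<in> set (tl (pawalk_verts v es))"
proof (induction es arbitrary: v)
  case (Cons e es)
  show ?case
  proof (cases "(s, t) = e")
    case True
    then show ?thesis using Cons.prems by (cases es) auto
  next
    case False
    then have "t \<in> set (tl (pawalk_verts (snd e) es))" using Cons by auto
    then show ?thesis by (cases "pawalk_verts (snd e) es") auto
  qed
qed simp

lemma pcas_rtrancl: "pcas v es w \<Longrightarrow> set es \<subseteq> R \<Longrightarrow> (v, w) \<in> R\<^sup>*"
  by (induction es arbitrary: v) (auto intro: converse_rtrancl_into_rtrancl)

text \<open>Repeating \<open>(u, v)\<close> would visit \<open>v\<close> twice. The reverse arc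
  could only come directly after it, and then \<open>u\<close> would be visited before the end.
  Length at least three excludes the closed walk along a single edge and back.\<close>

lemma cycle_arc_redundant:
  assumes "pcas u ((u, v) # es) u" "distinct (pawalk_verts v es)" "length es \<ge> 2"
  shows "(u, v) \<notin> set es" "(v, u) \<notin> set es"
proof -
  have es: "pcas v es u" using assms(1) by simp
  obtain t es' where es': "es = (v, t) # es'" using es assms(3) by (cases es) auto
  then have d: "v \<notin> set (pawalk_verts t es')" "distinct (pawalk_verts t es')" using assms(2) by auto
  show "(u, v) \<notin> set es"
    using pcas_snd_in_verts[OF es, of u v] d(1) es' by auto
  show "(v, u) \<notin> set es"
  proof
    assume "(v, u) \<in> set es"
    then have "t = u" using d(1) pcas_fst_in_verts[of v u es' t] es' by auto
    obtain e es'' where e: "es' = e # es''" using assms(3) es' by (cases es') auto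
    then have "u \<in> set (pawalk_verts (snd e) es'')"
      using es es' \<open>t = u\<close> by (auto intro: pcas_last_in_verts)
    then show False using d(2) e es es' \<open>t = u\<close> by auto
  qed
qed

text \<open>The ends of an edge on a cycle stay joined by the rest of the cycle. Deleting both
  orientations keeps the arc set symmetric and connected, against minimality.\<close>

lemma undirected_treeI:
  assumes W: "finite W" "W \<noteq> {}" and M: "M \<subseteq> W \<times> W" "sym M" "\<And>v. (v, v) \<notin> M" "conn_on M W"
    and minimal: "\<And>M'. M' \<subset> M \<Longrightarrow> sym M' \<Longrightarrow> \<not> conn_on M' W"
  shows "undirected_tree \<lparr>pverts = W, parcs = M\<rparr>"
proof -
  let ?T = "\<lparr>pverts = W, parcs = M\<rparr>"
  have MW: "M \<inter> W \<times> W = M" using M(1) by blast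
  have "pair_graph ?T"
  proof
    show "finite (parcs ?T)" using M(1) W(1) by (simp add: finite_subset)
    show "symmetric (with_proj ?T)" using M(2) by (simp add: symmetric_def)
  qed (use M(1,3) W(1) in auto)
  moreover have "Digraph_Component.connected (with_proj ?T)"
    unfolding Digraph_Component.connected_def strongly_connected_def reachable_def
  proof (intro conjI ballI)
    show "verts (with_proj (mk_symmetric (with_proj ?T))) \<noteq> {}" using W(2) by (simp add: mk_symmetric_def)
    fix u v assume "u \<in> verts (with_proj (mk_symmetric (with_proj ?T)))"
      "v \<in> verts (with_proj (mk_symmetric (with_proj ?T)))"
    then have uv: "u \<in> W" "v \<in> W" by (simp_all add: mk_symmetric_def)
    then have "(u, v) \<in> M\<^sup>*" using M(4) MW by (simp add: conn_on_def)
    then have "(u, v) \<in> rtrancl_on W M"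
      by (rule rtrancl_consistent_rtrancl_on) (use uv M(1) in auto)
    then have "(u, v) \<in> rtrancl_on W (parcs (mk_symmetric (with_proj ?T)))"
      by (rule rtrancl_on_mono[rotated 2]) (auto simp: mk_symmetric_def)
    then show "(u, v) \<in> rtrancl_on (verts (with_proj (mk_symmetric (with_proj ?T))))
        (arcs_ends (with_proj (mk_symmetric (with_proj ?T))))"
      by (simp add: mk_symmetric_def)
  qed
  moreover have False if cyc: "pre_digraph.cycle (with_proj ?T) p" "length p \<ge> 3" for p
  proof -
    obtain a where a: "set p \<subseteq> M" "pcas a p a" "distinct (tl (pawalk_verts a p))"
      using cyc(1) unfolding pre_digraph.cycle_def pre_digraph.awalk_def
      by (auto simp: cas_with_proj_eq awalk_verts_with_proj_eq)
    obtain u v es where p: "p = (u, v) # es" using cyc(2) by (cases p) auto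
    then have "a = u" using a(2) by simp
    then have es: "(u, v) \<notin> set es" "(v, u) \<notin> set es"
      using cycle_arc_redundant[of u v es] a p cyc(2) by auto
    define M' where "M' = M - {(u, v), (v, u)}"
    have "sym M'" using M(2) by (auto simp: M'_def sym_def)
    have "(v, u) \<in> M'\<^sup>*"
      using a p es \<open>a = u\<close> by (intro pcas_rtrancl[of v es u]) (auto simp: M'_def)
    then have "(u, v) \<in> M'\<^sup>*" using symD[OF sym_rtrancl[OF \<open>sym M'\<close>]] by blast
    then have "M \<subseteq> M'\<^sup>*" using \<open>(v, u) \<in> M'\<^sup>*\<close> by (auto simp: M'_def)
    then have "M\<^sup>* \<subseteq> M'\<^sup>*" by (rule rtrancl_subset_rtrancl)
    moreover have "M' \<inter> W \<times> W = M'" using M(1) by (auto simp: M'_def)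
    ultimately have "conn_on M' W" using M(4) MW by (auto simp: conn_on_def)
    moreover have "M' \<subset> M" using a(1) p by (auto simp: M'_def)
    ultimately show False using minimal \<open>sym M'\<close> by blast
  qed
  ultimately show ?thesis unfolding undirected_tree_def by blast
qed

lemma exists_spanning_tree:
  assumes W: "finite W" "W \<noteq> {}" and D: "D \<subseteq> W \<times> W" "sym D" "\<And>v. (v, v) \<notin> D" "conn_on D W"
  obtains M where "M \<subseteq> D" "undirected_tree \<lparr>pverts = W, parcs = M\<rparr>"
proof -
  let ?F = "{M. M \<subseteq> D \<and> sym M \<and> conn_on M W}"
  have "finite D" using W(1) D(1) by (simp add: finite_subset)
  then have "finite ?F" by (rule finite_subset[of _ "Pow D", rotated, OF finite_Pow_iff[THEN iffD2]]) auto
  moreover have "?F \<noteq> {}" using D by blast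
  ultimately have "\<exists>M\<in>?F. \<forall>M'\<in>?F. M' \<subseteq> M \<longrightarrow> M = M'" by (rule finite_has_minimal)
  then obtain M where M: "M \<in> ?F" "\<forall>M'\<in>?F. M' \<subseteq> M \<longrightarrow> M = M'" by (elim bexE)
  have "undirected_tree \<lparr>pverts = W, parcs = M\<rparr>"
  proof (rule undirected_treeI[OF W])
    show "\<not> conn_on M' W" if "M' \<subset> M" "sym M'" for M'
    proof
      assume "conn_on M' W"
      then have "M' \<in> ?F" using that M(1) by auto
      then show False using M(2) that(1) by blast
    qed
  qed (use M(1) D in auto)
  then show thesis using that[of M] M(1) by blast
qed

text \<open>Connectivity is defined through the symmetric closure, which leaves the arc set of a
  tree unchanged.\<close>

lemma tree_reachable:
  assumes "undirected_tree T" "u \<in> pverts T" "v \<in> pverts T"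
  shows "(u, v) \<in> (parcs T)\<^sup>*"
proof -
  have "pair_graph T" using assms(1) by (simp add: undirected_tree_def)
  then have "symmetric (with_proj T)"
    by (simp add: pair_graph_def pair_pseudo_graph_def pair_sym_digraph_def pair_sym_digraph_axioms_def)
  then have "sym (parcs T)" by (simp add: symmetric_def)
  then have "parcs (mk_symmetric (with_proj T)) = parcs T" by (auto simp: mk_symmetric_def dest: symD)
  moreover have "u \<rightarrow>\<^sup>*\<^bsub>with_proj (mk_symmetric (with_proj T))\<^esub> v"
    using assms unfolding undirected_tree_def Digraph_Component.connected_def strongly_connected_def
    by (simp add: mk_symmetric_def)
  ultimately show ?thesis by (auto simp: reachable_def dest: rtrancl_on_rtranclI)
qed

lemma tree_sym:
  assumes "undirected_tree T" "(u, v) \<in> parcs T"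
  shows "(v, u) \<in> parcs T"
proof -
  have "pair_graph T" using assms(1) by (simp add: undirected_tree_def)
  then have "symmetric (with_proj T)"
    by (simp add: pair_graph_def pair_pseudo_graph_def pair_sym_digraph_def pair_sym_digraph_axioms_def)
  then show ?thesis using assms(2) by (simp add: symmetric_def symD)
qed

lemma tree_out_arc:
  assumes "undirected_tree T" "u \<in> pverts T" "v \<in> pverts T" "u \<noteq> v"
  shows "\<exists>w. (u, w) \<in> parcs T"
  using tree_reachable[OF assms(1-3)] assms(4) by (auto elim: converse_rtranclE)

section \<open>Transfer to the burnt pancake graph and the degree argument\<close>

lemma wf_digraph_pair_graph: "pair_graph G \<Longrightarrow> wf_digraph (with_proj G)"
  by (auto simp: pair_graph_def pair_digraph_def pair_fin_digraph_def pair_wf_digraph_def wf_digraph_def)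

lemma burnt_pancake_simps:
  "pverts (burnt_pancake n) = arrangements {1..int n}"
  "parcs (burnt_pancake n) = reversal_arcs \<inter> arrangements {1..int n} \<times> arrangements {1..int n}"
proof -
  have eq: "signed_permutations n = arrangements {1..int n}"
    by (simp add: signed_permutations_def arrangements_def)
  then show "pverts (burnt_pancake n) = arrangements {1..int n}" by (simp add: burnt_pancake_def)
  have len: "length x = n" if "x \<in> arrangements {1..int n}" for x
    using length_arrangements[OF that] by simp
  show "parcs (burnt_pancake n) = reversal_arcs \<inter> arrangements {1..int n} \<times> arrangements {1..int n}"
    unfolding burnt_pancake_def eq reversal_arcs_def using len by fastforce
qed

text \<open>Spanning trees keep the vertex sets and only shrink the arc sets, so both kinds of
  disjointness are inherited.\<close>

lemma linked_imp_S_trees: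
  assumes "linked (parcs G) (pverts G) S r" "pair_graph G" "S \<noteq> {}"
  shows "\<exists>T. (\<forall>i<r. S_tree G S (T i)) \<and> internally_edge_disjoint S r T"
proof -
  obtain W D where
    WD: "\<And>i. i < r \<Longrightarrow> S \<subseteq> W i \<and> W i \<subseteq> pverts G \<and> D i \<subseteq> parcs G \<inter> W i \<times> W i \<and> sym (D i) \<and> conn_on (D i) (W i)"
    and dis: "\<And>i j. i < r \<Longrightarrow> j < r \<Longrightarrow> i \<noteq> j \<Longrightarrow> W i \<inter> W j = S \<and> D i \<inter> D j = {}"
    using assms(1) by (rule linkedE) blast
  have fin: "finite (pverts G)" and loop: "(v, v) \<notin> parcs G" for v
    using assms(2) by (auto simp: pair_graph_def pair_digraph_def pair_fin_digraph_def
        pair_fin_digraph_axioms_def pair_loopfree_digraph_def pair_loopfree_digraph_axioms_def)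
  have "\<exists>M. M \<subseteq> D i \<and> undirected_tree \<lparr>pverts = W i, parcs = M\<rparr>" if i: "i < r" for i
  proof -
    note w = WD[OF i]
    have "finite (W i)" using w fin finite_subset by blast
    moreover have "W i \<noteq> {}" using w assms(3) by blast
    moreover have "D i \<subseteq> W i \<times> W i" "\<And>v. (v, v) \<notin> D i" using w loop by blast+
    ultimately show ?thesis using exists_spanning_tree[of "W i" "D i"] w by metis
  qed
  then obtain M where M: "\<And>i. i < r \<Longrightarrow> M i \<subseteq> D i \<and> undirected_tree \<lparr>pverts = W i, parcs = M i\<rparr>"
    by metis
  let ?T = "\<lambda>i. \<lparr>pverts = W i, parcs = M i\<rparr>"
  have "S_tree G S (?T i)" if i: "i < r" for i
  proof -
    have t: "undirected_tree (?T i)" using M[OF i] by simp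
    then have "wf_digraph (with_proj (?T i))"
      by (intro wf_digraph_pair_graph) (simp add: undirected_tree_def)
    moreover have "W i \<subseteq> pverts G" "M i \<subseteq> parcs G" using M[OF i] WD[OF i] by blast+
    ultimately have "subgraph (with_proj (?T i)) (with_proj G)"
      using wf_digraph_pair_graph[OF assms(2)] by (simp add: subgraph_def compatible_def)
    then show ?thesis using t WD[OF i] by (simp add: S_tree_def)
  qed
  moreover have "internally_edge_disjoint S r ?T"
    unfolding internally_edge_disjoint_def
  proof (intro allI impI)
    fix i j assume ij: "i < r" "j < r" "i \<noteq> j"
    show "pverts (?T i) \<inter> pverts (?T j) = S \<and> parcs (?T i) \<inter> parcs (?T j) = {}"
      using M[OF ij(1)] M[OF ij(2)] dis[OF ij] by auto
  qed
  ultimately show ?thesis by (intro exI[of _ ?T]) simp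
qed

text \<open>One element chosen from each of the \<open>n\<close> disjoint sets already fills
  \<open>X\<close>. A second element of some set would be the chosen element of another.\<close>

lemma disjoint_family_exhausts:
  assumes "finite X" "card X \<le> n" "v \<in> X"
    and P: "\<And>i. i < n \<Longrightarrow> P i \<subseteq> X \<and> P i \<noteq> {}"
    and dis: "\<And>i j. i < n \<Longrightarrow> j < n \<Longrightarrow> i \<noteq> j \<Longrightarrow> P i \<inter> P j = {}"
  obtains i where "i < n" "P i = {v}"
proof -
  have "\<forall>i. \<exists>w. i < n \<longrightarrow> w \<in> P i" using P by blast
  then obtain f where f: "\<And>i. i < n \<Longrightarrow> f i \<in> P i" by metis
  have "inj_on f {..<n}"
  proof (rule inj_onI, rule ccontr)
    fix i j assume "i \<in> {..<n}" "j \<in> {..<n}" "f i = f j" "i \<noteq> j"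
    then show False using f[of i] f[of j] dis[of i j] by auto
  qed
  then have "card (f ` {..<n}) = n" by (simp add: card_image)
  moreover have sub: "f ` {..<n} \<subseteq> X" using f P by blast
  ultimately have img: "f ` {..<n} = X" using assms(1,2) by (intro card_seteq) auto
  then obtain i where i: "i < n" "f i = v" using assms(3) by blast
  have "w = v" if "w \<in> P i" for w
  proof -
    have "w \<in> X" using that P[OF i(1)] by blast
    then obtain j where j: "j < n" "f j = w" using img by blast
    have "w \<in> P j" using f[OF j(1)] j(2) by simp
    then have "i = j" using dis[OF i(1) j(1)] that by blast
    then show ?thesis using i j by simp
  qed
  then have "P i = {v}" using f[OF i(1)] i(2) by blast
  then show thesis using that i(1) by blast
qed

text \<open>
  If there are as many trees as arcs leaving \<open>x\<close>, each tree uses exactly one of them, and likewise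
  for \<open>y\<close>; the tree containing the edge \<open>xy\<close> then cannot leave \<open>{x, y}\<close>.
\<close>
lemma S_trees_less_degree:
  assumes T: "\<And>i. i < r \<Longrightarrow> S_tree G {x, y, z} (T i)" and dis: "internally_edge_disjoint {x, y, z} r T"
    and xyz: "x \<noteq> y" "x \<noteq> z" "y \<noteq> z" and adj: "(x, y) \<in> parcs G" "(y, x) \<in> parcs G"
    and deg: "finite {v. (x, v) \<in> parcs G}" "card {v. (x, v) \<in> parcs G} \<le> n"
      "finite {v. (y, v) \<in> parcs G}" "card {v. (y, v) \<in> parcs G} \<le> n"
  shows "r < n"
proof (rule ccontr)
  assume "\<not> r < n"
  \<comment> \<open>The first \<open>n\<close> trees suffice; their number then matches the degree
    bound in the counting lemma.\<close>
  then have T: "S_tree G {x, y, z} (T i)" if "i < n" for i using T that by simp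
  have tree: "undirected_tree (T i)" and mem: "x \<in> pverts (T i)" "y \<in> pverts (T i)" "z \<in> pverts (T i)"
    and sub: "parcs (T i) \<subseteq> parcs G" if "i < n" for i
    using T[OF that] by (auto simp: S_tree_def subgraph_def)
  have D: "parcs (T i) \<inter> parcs (T j) = {}" if "i < n" "j < n" "i \<noteq> j" for i j
    using dis that \<open>\<not> r < n\<close> by (simp add: internally_edge_disjoint_def)
  obtain i where i: "i < n" "{v. (x, v) \<in> parcs (T i)} = {y}"
  proof (rule disjoint_family_exhausts[OF deg(1,2), of y "\<lambda>i. {v. (x, v) \<in> parcs (T i)}"])
    show "{v. (x, v) \<in> parcs (T i)} \<subseteq> {v. (x, v) \<in> parcs G} \<and> {v. (x, v) \<in> parcs (T i)} \<noteq> {}"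
      if "i < n" for i
      using tree_out_arc[OF tree mem(1,2)] sub that xyz by blast
    show "{v. (x, v) \<in> parcs (T i)} \<inter> {v. (x, v) \<in> parcs (T j)} = {}" if "i < n" "j < n" "i \<noteq> j" for i j
      using D[OF that] by blast
  qed (use adj in auto)
  obtain j where j: "j < n" "{v. (y, v) \<in> parcs (T j)} = {x}"
  proof (rule disjoint_family_exhausts[OF deg(3,4), of x "\<lambda>i. {v. (y, v) \<in> parcs (T i)}"])
    show "{v. (y, v) \<in> parcs (T i)} \<subseteq> {v. (y, v) \<in> parcs G} \<and> {v. (y, v) \<in> parcs (T i)} \<noteq> {}"
      if "i < n" for i
      using tree_out_arc[OF tree mem(2,1)] sub that xyz by blast
    show "{v. (y, v) \<in> parcs (T i)} \<inter> {v. (y, v) \<in> parcs (T j)} = {}" if "i < n" "j < n" "i \<noteq> j" for i j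
      using D[OF that] by blast
  qed (use adj in auto)
  \<comment> \<open>Trees are symmetric, so the tree leaving \<open>x\<close> only towards
    \<open>y\<close> also contains the reverse arc and is the one singled out at
    \<open>y\<close>.\<close>
  have "(y, x) \<in> parcs (T i)" "(y, x) \<in> parcs (T j)" using tree_sym[OF tree[OF i(1)]] i(2) j(2) by blast+
  then have "i = j" using D[OF i(1) j(1)] by blast
  have "w \<in> {x, y}" if "(x, w) \<in> (parcs (T i))\<^sup>*" for w
    using that
  proof induction
    case (step v w)
    then have "(x, w) \<in> parcs (T i) \<or> (y, w) \<in> parcs (T i)" by blast
    then show ?case using i(2) j(2) \<open>i = j\<close> by blast
  qed simp
  then have "z \<in> {x, y}" using tree_reachable[OF tree mem(1,3)] i(1) by blast
  then show False using xyz by simp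
qed

lemma adjacent_triple:
  assumes "n \<ge> 2"
  obtains x y z where "x \<in> arrangements {1..int n}" "y \<in> arrangements {1..int n}"
    "z \<in> arrangements {1..int n}" "x \<noteq> y" "x \<noteq> z" "y \<noteq> z" "(x, y) \<in> reversal_arcs"
proof -
  have "card (arrangements {1..int n}) \<ge> card {1..int n} + 1" by (rule card_arrangements_ge) auto
  then have "arrangements {1..int n} \<noteq> {}" by auto
  then obtain x where x: "x \<in> arrangements {1..int n}" by blast
  let ?r = "\<lambda>i. signed_prefix_reversal i x"
  have inj: "inj_on ?r {0..n}" using inj_on_reversal[OF x] by simp
  have "length x = n" using length_arrangements[OF x] by simp
  show thesis
  \<comment> \<open>Reversals of lengths 1 and 2 both exist because \<open>n \<ge> 2\<close>, and
    they differ from \<open>x\<close> and from each other.\<close>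
  proof (rule that[of x "?r 1" "?r 2"])
    show "x \<noteq> ?r 1" "x \<noteq> ?r 2" "?r 1 \<noteq> ?r 2"
      using inj_onD[OF inj, of 0 1] inj_onD[OF inj, of 0 2] inj_onD[OF inj, of 1 2] assms
      by (auto simp: reversal_0)
    show "(x, ?r 1) \<in> reversal_arcs" using reversal_arcsI[of 1 x] \<open>length x = n\<close> assms by simp
  qed (use x reversal_arrangements in auto)
qed

theorem theorem1:
  fixes n :: nat
  assumes "n \<ge> 2"
  shows "generalized_connectivity 3 (burnt_pancake n) = n - 1"
proof -
  let ?G = "burnt_pancake n" and ?N = "{1..int n}"
  let ?trees = "\<lambda>S. {r. \<exists>T. (\<forall>i<r. S_tree ?G S (T i)) \<and> internally_edge_disjoint S r T}"
  note G = pair_graph_burnt_pancake[of n]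
  have lower: "n - 1 \<le> S_connectivity ?G S" if S: "S \<subseteq> pverts ?G" "card S = 3" for S
  proof -
    have "linked reversal_arcs (arrangements ?N) S (card ?N - 1)"
      by (rule linked_arrangements) (use S assms in \<open>simp_all add: burnt_pancake_simps\<close>)
    then have "linked reversal_arcs (pverts ?G) S (n - 1)" by (simp add: burnt_pancake_simps)
    then have "linked (parcs ?G) (pverts ?G) S (n - 1)"
      by (rule linked_mono) (simp add: burnt_pancake_simps)
    moreover have "S \<noteq> {}" using S(2) by auto
    ultimately have "n - 1 \<in> ?trees S" using linked_imp_S_trees[OF _ G] by simp
    then show ?thesis
      unfolding S_connectivity_def using S_connectivity_finite(1)[OF G, of S] S(2) by (intro Max_ge) auto
  qed
  \<comment> \<open>Any triple containing an edge attains the minimum: its connectivity lies between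
    the lower bound and the common degree \<open>n\<close>, which is excluded.\<close>
  obtain x y z where xyz: "x \<in> arrangements ?N" "y \<in> arrangements ?N" "z \<in> arrangements ?N"
    "x \<noteq> y" "x \<noteq> z" "y \<noteq> z" "(x, y) \<in> reversal_arcs"
    using adjacent_triple[OF assms] .
  let ?S = "{x, y, z}"
  have S: "?S \<subseteq> pverts ?G" "card ?S = 3" using xyz by (auto simp: burnt_pancake_simps)
  have deg: "finite {v. (u, v) \<in> parcs ?G}" "card {v. (u, v) \<in> parcs ?G} \<le> n" for u
  proof -
    have sub: "{v. (u, v) \<in> parcs ?G} \<subseteq> (\<lambda>i. signed_prefix_reversal i u) ` {1..n}"
      by (auto simp: burnt_pancake_def)
    then show "finite {v. (u, v) \<in> parcs ?G}" by (rule finite_subset) simp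
    have "card {v. (u, v) \<in> parcs ?G} \<le> card ((\<lambda>i. signed_prefix_reversal i u) ` {1..n})"
      using sub by (intro card_mono) auto
    also have "\<dots> \<le> n" using card_image_le[of "{1..n}" "\<lambda>i. signed_prefix_reversal i u"] by simp
    finally show "card {v. (u, v) \<in> parcs ?G} \<le> n" .
  qed
  have adj: "(x, y) \<in> parcs ?G" "(y, x) \<in> parcs ?G"
    using xyz symD[OF sym_reversal_arcs] by (auto simp: burnt_pancake_simps)
  have "S_connectivity ?G ?S \<in> ?trees ?S"
    unfolding S_connectivity_def using S_connectivity_finite[OF G, of ?S] S(2) by (intro Max_in) auto
  then obtain T where T: "\<And>i. i < S_connectivity ?G ?S \<Longrightarrow> S_tree ?G ?S (T i)"
    "internally_edge_disjoint ?S (S_connectivity ?G ?S) T" by blast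
  have upper: "S_connectivity ?G ?S < n"
    by (rule S_trees_less_degree[OF _ T(2) xyz(4-6) adj deg(1,2) deg(1,2)]) (rule T(1))
  have "card ?S \<le> card (pverts ?G)"
    by (rule card_mono[OF _ S(1)]) (simp add: burnt_pancake_simps finite_arrangements)
  then have fin: "finite {S_connectivity ?G S | S. S \<subseteq> pverts ?G \<and> card S = 3}"
    using generalized_connectivity_finite(1)[OF G, of 3] S(2) by simp
  have "n - 1 = S_connectivity ?G ?S" using lower[OF S] upper by linarith
  then have mem: "n - 1 \<in> {S_connectivity ?G S | S. S \<subseteq> pverts ?G \<and> card S = 3}"
    using S by (intro CollectI exI[of _ ?S] conjI)
  show ?thesis
    unfolding generalized_connectivity_def
  proof (rule Min_eqI[OF fin _ mem])
    fix k assume "k \<in> {S_connectivity ?G S | S. S \<subseteq> pverts ?G \<and> card S = 3}"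
    then obtain S where "k = S_connectivity ?G S" "S \<subseteq> pverts ?G" "card S = 3" by blast
    then show "n - 1 \<le> k" using lower by simp
  qed
qed

end
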